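(* Let $\gamma$ be a positive integer. Consider the ARX system described in the context, suppose that Assumption A (with this $\gamma$) of the context holds, and let $P_k$ be the matrices generated by the recursive least-squares algorithm. Then for any constant $\varepsilon>0$, as $k\to\infty$, $$\mathbb{P}\left(\left\Vert\bar{\mathbb{E}}[\phi_k\phi_k^T]-\frac{P_k^{-1}}{k}\right\Vert_2>\varepsilon\right)=O\left(\frac1{k^\gamma}\right),$$ $$\mathbb{P}\left(\Vert P_k\Vert_2>\frac{2\Vert(\bar{\mathbb{E}}[\phi_k\phi_k^T])^{-1}\Vert_2}{k}\right)=O\left(\frac1{k^\gamma}\right).$$
   Context: **System.** Let $m,n$ be the orders of the system. The ARX system is $$y_k+a_1y_{k-1}+\cdots+a_my_{k-m}=b_1u_{k-1}+\cdots+b_nu_{k-n}+d_k,\qquad k\ge1,$$ where $u_k\in\mathbb{R}$ is the input, $y_k\in\mathbb{R}$ the output, $d_k\in\mathbb{R}$ the unmeasurable noise, $a_i,b_i\in\mathbb{R}$ are unknown parameters, and $y_k=0$ for $k\le0$, $u_k=0$ for $k<0$. The regression vector is $\phi_k=[-y_{k-1},\dots,-y_{k-m},u_{k-1},\dots,u_{k-n}]^T\in\mathbb{R}^{m+n}$, $k\ge1$. **Matrices $P_k$ of the RLS algorithm.** Given a (deterministic) symmetric positive definite matrix $P_0\in\mathbb{R}^{(m+n)\times(m+n)}$, for $k\ge1$: $$P_k=P_{k-1}-\alpha_kP_{k-1}\phi_k\phi_k^TP_{k-1},\qquad \alpha_k=(1+\phi_k^TP_{k-1}\phi_k)^{-1}.$$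 **Averaged expectation.** For a process $\{t_k\}$, $\bar{\mathbb{E}}[t_k]=\lim_{k\to\infty}\frac1k\sum_{l=1}^k\mathbb{E}[t_l]$ (entrywise for matrices); in particular $\bar{\mathbb{E}}[\phi_k\phi_k^T]$ is a fixed matrix. **Quasi-stationarity.** A real process $\{t_k\}$ is quasi-stationary if for some constant $C>0$, $\sup_k|\mathbb{E}[t_k]|<C$, $\sup_{i,j}|\mathbb{E}[t_it_j]|<C$, and $R^t_\tau=\bar{\mathbb{E}}[t_kt_{k-\tau}]$ exists for every $\tau\in\mathbb{Z}$. **Assumption A (with parameter $\gamma$).** There are a bounded deterministic sequence $\{r_k\}_{k\ge0}$ and a sequence $\{e_k\}_{k\ge0}$ of independent random variables with zero mean, variance $\delta_e^2$ and $\sup_k\mathbb{E}[|e_k|^{4\gamma}]<\infty$ (with $r_k=e_k=0$ for $k<0$), and deterministic real filters $f_i^{(j)}(k)$, $j=1,2,3,4$, such that $$y_k=\sum_{i=1}^\infty f_i^{(1)}(k)r_{k-i}+\sum_{i=0}^\infty f_i^{(2)}(k)e_{k-i}\ (k\ge1),\qquad u_k=\sum_{i=0}^\infty f_i^{(3)}(k)r_{k-i}+\sum_{i=0}^\infty f_i^{(4)}(k)e_{k-i}\ (k\ge0),$$ and: (i) (uniform stability) there is a sequence $\{f_i\}_{i\ge0}$ with $\sup_{k,j}|f_i^{(j)}(k)|\le|f_i|$ for all $i$ and $\sum_i|f_i|<\infty$; (ii) (joint quasi-stationarity) $\{y_k\}_{k\ge1}$ and $\{u_k\}_{k\ge0}$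 are quasi-stationary, and $R^{yu}_\tau=\bar{\mathbb{E}}[y_ku_{k-\tau}]$ exists for every $\tau\in\mathbb{Z}$; (iii) (persistent excitation) the matrix $\bar{\mathbb{E}}[\phi_k\phi_k^T]$ (whose entries are, up to sign, values of the covariance functions $R^y,R^u$ and the cross-covariance function of $y$ and $u$) is positive definite. $\Vert\cdot\Vert_2$ is the matrix 2-norm (spectral norm). *)

theory Defs
  imports "HOL-Probability.Probability"
begin

text \<open>
  Signals are indexed by all integers, so that delayed values such as \<open>y (k - i)\<close> make sense
  and the conventions ``zero for negative times'' are explicit hypotheses.
\<close>

type_synonym 'a process = "int \<Rightarrow> 'a \<Rightarrow> real"

definition positive_definite :: "real ^ 'd ^ 'd \<Rightarrow> bool" where
  "positive_definite A \<longleftrightarrow> transpose A = A \<and> (\<forall>x. x \<noteq> 0 \<longrightarrow> 0 < x \<bullet> (A *v x))"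

definition spectral_norm :: "real ^ 'd ^ 'd \<Rightarrow> real" where
  "spectral_norm A = onorm (\<lambda>x. A *v x)"

definition outer_product :: "real ^ 'd \<Rightarrow> real ^ 'd \<Rightarrow> real ^ 'd ^ 'd" where
  "outer_product v w = (\<chi> i j. v $ i * w $ j)"


definition mean_upto :: "'a measure \<Rightarrow> 'a process \<Rightarrow> nat \<Rightarrow> real" where
  "mean_upto M t k = (1 / real k) * (\<Sum>l = 1..int k. integral\<^sup>L M (t l))"

definition avg_exp_exists :: "'a measure \<Rightarrow> 'a process \<Rightarrow> bool" where
  "avg_exp_exists M t \<longleftrightarrow> convergent (mean_upto M t)"

text \<open>\<open>avg_exp\<close> is meaningful only under \<open>avg_exp_exists\<close>.\<close>

definition avg_exp :: "'a measure \<Rightarrow> 'a process \<Rightarrow> real" where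
  "avg_exp M t = lim (mean_upto M t)"

definition avg_exp_matrix ::
    "'a measure \<Rightarrow> (int \<Rightarrow> 'a \<Rightarrow> real ^ 'd ^ 'd) \<Rightarrow> real ^ 'd ^ 'd" where
  "avg_exp_matrix M X = (\<chi> i j. avg_exp M (\<lambda>k \<omega>. X k \<omega> $ i $ j))"

text \<open>
  Integrability is spelled out because the Bochner integral of a non-integrable function is 0.
\<close>

definition quasi_stationary :: "'a measure \<Rightarrow> 'a process \<Rightarrow> bool" where
  "quasi_stationary M t \<longleftrightarrow>
     (\<forall>k. integrable M (t k)) \<and>
     (\<forall>i j. integrable M (\<lambda>\<omega>. t i \<omega> * t j \<omega>)) \<and>
     (\<exists>C>0. (\<forall>k. \<bar>integral\<^sup>L M (t k)\<bar> < C) \<and>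
            (\<forall>i j. \<bar>integral\<^sup>L M (\<lambda>\<omega>. t i \<omega> * t j \<omega>)\<bar> < C)) \<and>
     (\<forall>\<tau>. avg_exp_exists M (\<lambda>k \<omega>. t k \<omega> * t (k - \<tau>) \<omega>))"


definition arx_system ::
    "'a measure \<Rightarrow> nat \<Rightarrow> nat \<Rightarrow> (nat \<Rightarrow> real) \<Rightarrow> (nat \<Rightarrow> real) \<Rightarrow>
     'a process \<Rightarrow> 'a process \<Rightarrow> 'a process \<Rightarrow> bool" where
  "arx_system M m n a b y u d \<longleftrightarrow>
     (\<forall>k. y k \<in> borel_measurable M \<and> u k \<in> borel_measurable M) \<and>
     (\<forall>k\<ge>1. d k \<in> borel_measurable M) \<and>
     (\<forall>k\<le>0. \<forall>\<omega>\<in>space M. y k \<omega> = 0) \<and>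
     (\<forall>k<0. \<forall>\<omega>\<in>space M. u k \<omega> = 0) \<and>
     (\<forall>k\<ge>1. \<forall>\<omega>\<in>space M.
        y k \<omega> + (\<Sum>i=1..m. a i * y (k - int i) \<omega>)
          = (\<Sum>i=1..n. b i * u (k - int i) \<omega>) + d k \<omega>)"

text \<open>
  The coordinates of the regression vector are indexed by a finite type \<open>'d\<close>, where
  \<open>pos :: 'd \<Rightarrow> nat\<close> is a bijection onto \<open>{1..m + n}\<close> giving the position of each coordinate.
\<close>

definition regressor ::
    "nat \<Rightarrow> ('d::finite \<Rightarrow> nat) \<Rightarrow> 'a process \<Rightarrow> 'a process \<Rightarrow> int \<Rightarrow> 'a \<Rightarrow> real ^ 'd" where
  "regressor m pos y u k \<omega> =
     (\<chi> c. if pos c \<le> m then - y (k - int (pos c)) \<omega> else u (k - int (pos c - m)) \<omega>)"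

primrec rls_matrix ::
    "real ^ 'd ^ 'd \<Rightarrow> (nat \<Rightarrow> real ^ 'd) \<Rightarrow> nat \<Rightarrow> real ^ 'd ^ 'd" where
  "rls_matrix P0 \<phi> 0 = P0"
| "rls_matrix P0 \<phi> (Suc k) =
     (let P = rls_matrix P0 \<phi> k; v = \<phi> (Suc k); \<alpha> = inverse (1 + v \<bullet> (P *v v))
      in P - \<alpha> *\<^sub>R (P ** outer_product v v ** P))"

definition mean_regressor_matrix ::
    "'a measure \<Rightarrow> nat \<Rightarrow> ('d::finite \<Rightarrow> nat) \<Rightarrow> 'a process \<Rightarrow> 'a process \<Rightarrow> real ^ 'd ^ 'd" where
  "mean_regressor_matrix M m pos y u =
     avg_exp_matrix M (\<lambda>k \<omega>. outer_product (regressor m pos y u k \<omega>) (regressor m pos y u k \<omega>))"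


definition driving_signals ::
    "'a measure \<Rightarrow> nat \<Rightarrow> (int \<Rightarrow> real) \<Rightarrow> 'a process \<Rightarrow> bool" where
  "driving_signals M \<gamma> r e \<longleftrightarrow>
     bounded (range r) \<and>
     (\<forall>k<0. r k = 0) \<and>
     (\<forall>k<0. \<forall>\<omega>\<in>space M. e k \<omega> = 0) \<and>
     prob_space.indep_vars M (\<lambda>_. borel) e {0..} \<and>
     (\<forall>k\<ge>0. integrable M (e k) \<and> integral\<^sup>L M (e k) = 0) \<and>
     (\<exists>\<delta>::real. \<forall>k\<ge>0. integral\<^sup>L M (\<lambda>\<omega>. (e k \<omega> - integral\<^sup>L M (e k))\<^sup>2) = \<delta>\<^sup>2) \<and>
     (\<forall>k\<ge>0. integrable M (\<lambda>\<omega>. \<bar>e k \<omega>\<bar> ^ (4 * \<gamma>))) \<and>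
     bdd_above ((\<lambda>k. integral\<^sup>L M (\<lambda>\<omega>. \<bar>e k \<omega>\<bar> ^ (4 * \<gamma>))) ` {0..})"

text \<open>
  \<open>f j i k\<close> is the coefficient $f_i^{(j)}(k)$. All series are finite sums at each time,
  because \<open>r\<close> and \<open>e\<close> vanish at negative times. The first one starts at lag 1.
\<close>

definition filter_representation ::
    "'a measure \<Rightarrow> (int \<Rightarrow> real) \<Rightarrow> 'a process \<Rightarrow> (nat \<Rightarrow> nat \<Rightarrow> int \<Rightarrow> real) \<Rightarrow>
     'a process \<Rightarrow> 'a process \<Rightarrow> bool" where
  "filter_representation M r e f y u \<longleftrightarrow>
     (\<forall>k\<ge>1. \<forall>\<omega>\<in>space M. y k \<omega> =
        (\<Sum>i. f 1 (Suc i) k * r (k - int (Suc i))) + (\<Sum>i. f 2 i k * e (k - int i) \<omega>)) \<and>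
     (\<forall>k\<ge>0. \<forall>\<omega>\<in>space M. u k \<omega> =
        (\<Sum>i. f 3 i k * r (k - int i)) + (\<Sum>i. f 4 i k * e (k - int i) \<omega>))"

definition uniformly_stable :: "(nat \<Rightarrow> nat \<Rightarrow> int \<Rightarrow> real) \<Rightarrow> bool" where
  "uniformly_stable f \<longleftrightarrow>
     (\<exists>g :: nat \<Rightarrow> real. summable (\<lambda>i. \<bar>g i\<bar>) \<and>
        (\<forall>k\<ge>1. \<forall>i\<ge>1. \<bar>f 1 i k\<bar> \<le> \<bar>g i\<bar>) \<and>
        (\<forall>k\<ge>1. \<forall>i. \<bar>f 2 i k\<bar> \<le> \<bar>g i\<bar>) \<and>
        (\<forall>k\<ge>0. \<forall>i. \<bar>f 3 i k\<bar> \<le> \<bar>g i\<bar>) \<and>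
        (\<forall>k\<ge>0. \<forall>i. \<bar>f 4 i k\<bar> \<le> \<bar>g i\<bar>))"

definition jointly_quasi_stationary :: "'a measure \<Rightarrow> 'a process \<Rightarrow> 'a process \<Rightarrow> bool" where
  "jointly_quasi_stationary M y u \<longleftrightarrow>
     quasi_stationary M y \<and> quasi_stationary M u \<and>
     (\<forall>\<tau>. avg_exp_exists M (\<lambda>k \<omega>. y k \<omega> * u (k - \<tau>) \<omega>))"

text \<open>
  In the last clause the limits defining \<open>mean_regressor_matrix\<close> exist by joint quasi-stationarity,
  since its entries are, up to sign, values of the (cross-)covariance functions of \<open>y\<close> and \<open>u\<close>.
\<close>

definition assumption_A ::
    "'a measure \<Rightarrow> nat \<Rightarrow> nat \<Rightarrow> ('d::finite \<Rightarrow> nat) \<Rightarrow> 'a process \<Rightarrow> 'a process \<Rightarrow> bool" where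
  "assumption_A M \<gamma> m pos y u \<longleftrightarrow>
     (\<exists>r e f. driving_signals M \<gamma> r e \<and> filter_representation M r e f y u \<and> uniformly_stable f) \<and>
     jointly_quasi_stationary M y u \<and>
     positive_definite (mean_regressor_matrix M m pos y u)"

end

theory Submission
  imports Defs
begin

text \<open>
  The inverses of the recursive least-squares matrices are explicit:
  \<open>P\<^sub>k\<^bsup>-1\<^esup> = P\<^sub>0\<^bsup>-1\<^esup> + \<Sum>\<^sub>l \<phi>\<^sub>l \<phi>\<^sub>l\<^sup>T\<close>, where \<open>l\<close> runs from 1 to \<open>k\<close>
  (\<open>rls_matrix_inverse\<close>). Hence \<open>P\<^sub>k\<^bsup>-1\<^esup> / k\<close> differs from the limit \<open>\<Phi>\<close> of the averaged
  expectations by a deterministic error that tends to 0 and by the averages of the centered products of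
  the entries of the regressors. The first claim is therefore a bound on the deviations of these
  averages, entry by entry. The second claim follows from the first: if \<open>P\<^sub>k\<^bsup>-1\<^esup> / k\<close> is close enough to
  \<open>\<Phi>\<close>, then its inverse \<open>k P\<^sub>k\<close> is at most twice as large as \<open>\<Phi>\<^bsup>-1\<^esup>\<close>
  (\<open>spectral_norm_inverse_perturbation\<close>).

  The deviation bound is Markov's inequality for the moment of order \<open>2\<gamma>\<close>. It needs that this
  moment of the sum of \<open>k\<close> centered products grows only like \<open>k\<^bsup>\<gamma>\<^esup>\<close> (\<open>product_sum_moment\<close>).
  Both factors are superpositions of lagged noise variables with summable weights, together with a
  deterministic part that is treated as a multiple of the constant signal 1. By convexity
  (\<open>weighted_even_power_sum\<close>) it suffices to bound, uniformly over all pairs of lags, the sums of centered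
  products of two lagged noise variables. For a fixed pair of lags these products are martingale
  differences: the more recent of the two variables is independent of the older one and of all earlier
  products, and enters through a factor of mean zero (\<open>centered_product_decomposition\<close>). Their moments of
  order \<open>2\<gamma>\<close> are bounded because the noise has \<open>4\<gamma>\<close> moments.

  That martingale differences have this moment growth is elementary for an even exponent
  (\<open>martingale_difference_moment\<close>): in the expansion of \<open>(s + x)\<^bsup>2\<gamma>\<^esup>\<close>, the term linear in the new
  difference \<open>x\<close> has expectation 0, and the terms of higher order increase the moment by a relative
  amount of order \<open>1 / k\<close> and an absolute amount of order \<open>k\<^bsup>\<gamma>-1\<^esup>\<close>, which over \<open>k\<close> steps add up to
  order \<open>k\<^bsup>\<gamma>\<^esup>\<close>.
\<close>

section \<open>The matrices of the recursion\<close>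

lemma outer_product_vector: "outer_product v w *v x = (w \<bullet> x) *\<^sub>R v"
  by (simp add: outer_product_def matrix_vector_mult_def vec_eq_iff inner_vec_def
      sum_distrib_left sum_distrib_right mult_ac)

lemma matrix_inv_eqI:
  fixes A B :: "real ^ 'd ^ 'd"
  assumes "B ** A = mat 1"
  shows "matrix_inv B = A"
proof -
  have AB: "A ** B = mat 1"
    using assms matrix_left_right_inverse1 by blast
  have "B ** matrix_inv B = mat 1 \<and> matrix_inv B ** B = mat 1"
    unfolding matrix_inv_def by (rule someI[where x = A]) (use assms AB in auto)
  then show ?thesis
    by (metis AB matrix_mul_assoc matrix_mul_lid matrix_mul_rid)
qed

lemma positive_definite_inverse:
  fixes A :: "real ^ 'd ^ 'd"
  assumes "positive_definite A"
  shows "A ** matrix_inv A = mat 1" "matrix_inv A ** A = mat 1"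
proof -
  have "x = 0" if "A *v x = 0" for x
    using assms that unfolding positive_definite_def by (metis inner_zero_right less_irrefl)
  then obtain B where "B ** A = mat 1"
    using matrix_left_invertible_ker by blast
  moreover from this have "A ** B = mat 1"
    using matrix_left_right_inverse1 by blast
  ultimately show "A ** matrix_inv A = mat 1" "matrix_inv A ** A = mat 1"
    using matrix_inv_eqI[of A B] by auto
qed

lemma rls_step_inverse:
  fixes P R :: "real ^ 'd ^ 'd"
  assumes PR: "P ** R = mat 1" and psd: "\<And>x. 0 \<le> x \<bullet> (R *v x)"
  shows "(P - inverse (1 + v \<bullet> (P *v v)) *\<^sub>R (P ** outer_product v v ** P))
           ** (R + outer_product v v) = mat 1"
proof -
  define q where "q = v \<bullet> (P *v v)"
  have "R ** P = mat 1"
    using PR matrix_left_right_inverse1 by blast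
  \<comment> \<open>Writing \<open>v = R (P v)\<close> turns \<open>q\<close> into the value at \<open>P v\<close> of the quadratic form of \<open>R\<close>.\<close>
  then have "R *v (P *v v) = v"
    by (simp add: matrix_vector_mul_assoc)
  then have q: "1 + q \<noteq> 0"
    using psd[of "P *v v"] by (simp add: q_def inner_commute)
  have PRx: "P *v (R *v x) = x" for x
    by (simp add: matrix_vector_mul_assoc PR)
  have "(P - inverse (1 + q) *\<^sub>R (P ** outer_product v v ** P))
           *v ((R + outer_product v v) *v x) = x" for x
  proof -
    define w where "w = (R + outer_product v v) *v x"
    have w: "P *v w = x + (v \<bullet> x) *\<^sub>R (P *v v)"
      by (simp add: w_def matrix_vector_mult_add_rdistrib matrix_vector_right_distrib PRx
          outer_product_vector matrix_vector_mult_scaleR)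
    have "inverse (1 + q) * (v \<bullet> (P *v w)) = v \<bullet> x"
      using q by (simp add: w inner_add_right q_def[symmetric] field_simps)
    moreover have "(P - inverse (1 + q) *\<^sub>R (P ** outer_product v v ** P)) *v w
        = P *v w - (inverse (1 + q) * (v \<bullet> (P *v w))) *\<^sub>R (P *v v)"
      by (simp add: matrix_vector_mult_diff_rdistrib scaleR_matrix_vector_assoc[symmetric]
          matrix_vector_mul_assoc[symmetric] outer_product_vector matrix_vector_mult_scaleR)
    ultimately show ?thesis
      by (simp add: w w_def[symmetric])
  qed
  then show ?thesis
    unfolding q_def[symmetric] by (simp add: matrix_eq matrix_vector_mul_assoc)
qed

text \<open>
  The recursion for \<open>P\<^sub>k\<close> is the Sherman--Morrison formula for adding a rank-one term to
  \<open>P\<^sub>k\<^bsup>-1\<^esup>\<close>, so the inverse is a plain sum over the regressors. Positive semidefiniteness of the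
  inverse is carried through the induction because it keeps the denominator
  \<open>1 + v \<bullet> P v\<close> away from zero.
\<close>

theorem rls_matrix_inverse:
  fixes P0 :: "real ^ 'd ^ 'd"
  assumes "positive_definite P0"
  shows "matrix_inv (rls_matrix P0 \<phi> k)
       = matrix_inv P0 + (\<Sum>l<k. outer_product (\<phi> (Suc l)) (\<phi> (Suc l)))"
    and "rls_matrix P0 \<phi> k ** matrix_inv (rls_matrix P0 \<phi> k) = mat 1"
proof -
  define R where "R = (\<lambda>k. matrix_inv P0 + (\<Sum>l<k. outer_product (\<phi> (Suc l)) (\<phi> (Suc l))))"
  have "rls_matrix P0 \<phi> k ** R k = mat 1 \<and> (\<forall>x. 0 \<le> x \<bullet> (R k *v x))"
  proof (induction k)
    case 0
    have "0 \<le> x \<bullet> (matrix_inv P0 *v x)" for x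
    proof -
      define z where "z = matrix_inv P0 *v x"
      have "x = P0 *v z"
        by (simp add: z_def matrix_vector_mul_assoc positive_definite_inverse[OF assms])
      then show ?thesis
        using assms unfolding positive_definite_def z_def[symmetric]
        by (metis inner_commute inner_zero_left less_eq_real_def)
    qed
    then show ?case
      using positive_definite_inverse[OF assms] by (simp add: R_def)
  next
    case (Suc k)
    let ?v = "\<phi> (Suc k)"
    have R: "R (Suc k) = R k + outer_product ?v ?v"
      by (simp add: R_def add.assoc)
    have "x \<bullet> (R (Suc k) *v x) = x \<bullet> (R k *v x) + (?v \<bullet> x)\<^sup>2" for x
      by (simp add: R matrix_vector_mult_add_rdistrib outer_product_vector inner_add_right
          power2_eq_square inner_commute)
    then show ?case
      using rls_step_inverse[of "rls_matrix P0 \<phi> k" "R k" ?v] Suc.IH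
      by (simp add: Let_def R)
  qed
  then have "rls_matrix P0 \<phi> k ** R k = mat 1" by blast
  with matrix_inv_eqI[OF this] show
    "matrix_inv (rls_matrix P0 \<phi> k)
       = matrix_inv P0 + (\<Sum>l<k. outer_product (\<phi> (Suc l)) (\<phi> (Suc l)))"
    "rls_matrix P0 \<phi> k ** matrix_inv (rls_matrix P0 \<phi> k) = mat 1"
    by (auto simp: R_def)
qed

lemma spectral_norm_bound: "norm (A *v x) \<le> spectral_norm A * norm x"
  unfolding spectral_norm_def by (rule onorm) (rule matrix_vector_mul_bounded_linear)

lemma spectral_norm_inverse_pos:
  fixes A :: "real ^ 'd ^ 'd"
  assumes "A ** B = mat 1"
  shows "0 < spectral_norm A"
proof -
  define x :: "real ^ 'd" where "x = (\<chi> i. 1)"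
  have "x \<noteq> 0" by (simp add: x_def vec_eq_iff)
  moreover have "A *v (B *v x) = x" by (simp add: matrix_vector_mul_assoc assms)
  ultimately have "0 < norm x" "norm x \<le> spectral_norm A * norm (B *v x)"
    using spectral_norm_bound[of A "B *v x"] by simp_all
  then have "0 < spectral_norm A * norm (B *v x)" by linarith
  then show ?thesis
    using norm_ge_zero[of "B *v x"] by (simp add: zero_less_mult_iff)
qed

text \<open>
  If \<open>N\<close> is the norm of \<open>A\<^bsup>-1\<^esup>\<close>, then \<open>A\<close> stretches every vector by at least
  \<open>1 / N\<close>. A perturbation of norm at most \<open>1 / (2 N)\<close> still stretches by at least \<open>1 / (2 N)\<close>, and
  this is a bound for its inverse. Applied to \<open>R = P\<^sub>k\<^bsup>-1\<^esup>\<close>, it shows that \<open>P\<^sub>k\<close>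
  can be large only where \<open>P\<^sub>k\<^bsup>-1\<^esup> / k\<close> deviates; the threshold twice the norm of the inverse comes from here.
\<close>

lemma spectral_norm_inverse_perturbation:
  fixes A R P :: "real ^ 'd ^ 'd"
  assumes A: "matrix_inv A ** A = mat 1" and PR: "P ** R = mat 1" and k: "0 < k"
    and close: "spectral_norm (A - (1 / k) *\<^sub>R R) \<le> 1 / (2 * spectral_norm (matrix_inv A))"
  shows "spectral_norm P \<le> 2 * spectral_norm (matrix_inv A) / k"
proof -
  define N where "N = spectral_norm (matrix_inv A)"
  have N: "0 < N" unfolding N_def by (rule spectral_norm_inverse_pos[OF A])
  have RP: "R ** P = mat 1" using PR matrix_left_right_inverse1 by blast
  have "norm (P *v w) \<le> (2 * N / k) * norm w" for w
  proof -
    define x where "x = P *v w"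
    have w: "R *v x = w" by (simp add: x_def matrix_vector_mul_assoc RP)
    have "x = matrix_inv A *v (A *v x)" by (simp add: matrix_vector_mul_assoc A)
    then have 1: "norm x \<le> N * norm (A *v x)"
      using spectral_norm_bound[of "matrix_inv A" "A *v x"] by (simp add: N_def)
    have "A *v x = (A - (1 / k) *\<^sub>R R) *v x + (1 / k) *\<^sub>R w"
      by (simp add: matrix_vector_mult_diff_rdistrib scaleR_matrix_vector_assoc[symmetric] w)
    then have "norm (A *v x) \<le> norm ((A - (1 / k) *\<^sub>R R) *v x) + norm w / k"
      using norm_triangle_ineq[of "(A - (1 / k) *\<^sub>R R) *v x" "(1 / k) *\<^sub>R w"] k by simp
    also have "norm ((A - (1 / k) *\<^sub>R R) *v x) \<le> 1 / (2 * N) * norm x"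
      using spectral_norm_bound close unfolding N_def
      by (rule order.trans[OF _ mult_right_mono]) simp
    finally have "N * norm (A *v x) \<le> N * (1 / (2 * N) * norm x + norm w / k)"
      using N by simp
    also have "\<dots> = norm x / 2 + N * norm w / k"
      using N by (simp add: field_simps)
    finally have "norm x \<le> 2 * (N * norm w / k)" using 1 by linarith
    then show ?thesis by (simp add: x_def)
  qed
  then show ?thesis
    unfolding spectral_norm_def N_def by (intro onorm_le)
qed

section \<open>Elementary inequalities\<close>

lemma even_nonneg: "0 \<le> (x :: real) ^ (2 * q)"
  by (simp add: power_mult)

lemma norm_even_power_le:
  fixes x c :: real
  assumes "x ^ (2 * q) \<le> c"
  shows "norm (x ^ (2 * q)) \<le> norm c"
  using assms zero_le_even_power[of "2 * q" x] by simp

text \<open>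
  Taylor expansion to first order: every later term of the binomial sum contains \<open>x\<^sup>2\<close>, and
  the remaining factor of degree \<open>q\<close> is at most the \<open>q\<close>-th power of the larger of
  \<open>\<bar>s\<bar>\<close> and \<open>\<bar>x\<bar>\<close>.
\<close>

lemma power_add_second_order:
  fixes s x :: real
  shows "\<bar>(s + x) ^ (q + 2) - s ^ (q + 2) - real (q + 2) * s ^ (q + 1) * x\<bar>
           \<le> 2 ^ (q + 2) * (x\<^sup>2 * (\<bar>s\<bar> ^ q + \<bar>x\<bar> ^ q))"
proof -
  define p where "p = q + 2"
  let ?t = "\<lambda>j. real (p choose j) * s ^ (p - j) * x ^ j"
  have eq: "(s + x) ^ p = (\<Sum>j\<le>p. ?t j)"
    by (subst add.commute) (simp add: binomial_ring mult_ac)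
  have "{..p} = {0, 1} \<union> {2..p}" by (auto simp: p_def)
  then have "(\<Sum>j\<le>p. ?t j) = s ^ p + real p * s ^ (q + 1) * x + (\<Sum>j\<in>{2..p}. ?t j)"
    by (simp add: sum.union_disjoint) (simp add: p_def)
  with eq have "\<bar>(s + x) ^ p - s ^ p - real p * s ^ (q + 1) * x\<bar> = \<bar>\<Sum>j\<in>{2..p}. ?t j\<bar>"
    by simp
  also have "\<dots> \<le> (\<Sum>j\<in>{2..p}. \<bar>?t j\<bar>)" by (rule sum_abs)
  also have "\<dots> \<le> (\<Sum>j\<in>{2..p}. real (p choose j) * (x\<^sup>2 * (\<bar>s\<bar> ^ q + \<bar>x\<bar> ^ q)))"
  proof (rule sum_mono)
    fix j assume j: "j \<in> {2..p}"
    then obtain i where i: "j = i + 2" "i \<le> q"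
      by (metis atLeastAtMost_iff p_def add_le_cancel_right le_add_diff_inverse2)
    have "\<bar>s\<bar> ^ (q - i) * \<bar>x\<bar> ^ i \<le> max \<bar>s\<bar> \<bar>x\<bar> ^ (q - i) * max \<bar>s\<bar> \<bar>x\<bar> ^ i"
      by (intro mult_mono power_mono) auto
    also have "\<dots> = max \<bar>s\<bar> \<bar>x\<bar> ^ q" using i by (simp flip: power_add)
    also have "\<dots> \<le> \<bar>s\<bar> ^ q + \<bar>x\<bar> ^ q" by (cases "\<bar>s\<bar> \<le> \<bar>x\<bar>") (auto simp: max_def)
    finally have *: "\<bar>s\<bar> ^ (q - i) * \<bar>x\<bar> ^ i \<le> \<bar>s\<bar> ^ q + \<bar>x\<bar> ^ q" .
    have "\<bar>?t j\<bar> = real (p choose j) * (x\<^sup>2 * (\<bar>s\<bar> ^ (q - i) * \<bar>x\<bar> ^ i))"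
      using i by (simp add: abs_mult power_abs p_def power_add power2_eq_square)
    also have "\<dots> \<le> real (p choose j) * (x\<^sup>2 * (\<bar>s\<bar> ^ q + \<bar>x\<bar> ^ q))"
      by (intro mult_left_mono *) auto
    finally show "\<bar>?t j\<bar> \<le> real (p choose j) * (x\<^sup>2 * (\<bar>s\<bar> ^ q + \<bar>x\<bar> ^ q))" .
  qed
  also have "\<dots> = (\<Sum>j\<in>{2..p}. real (p choose j)) * (x\<^sup>2 * (\<bar>s\<bar> ^ q + \<bar>x\<bar> ^ q))"
    by (simp add: sum_distrib_right)
  also have "\<dots> \<le> 2 ^ p * (x\<^sup>2 * (\<bar>s\<bar> ^ q + \<bar>x\<bar> ^ q))"
  proof (rule mult_right_mono)
    have "(\<Sum>j\<in>{2..p}. real (p choose j)) \<le> (\<Sum>j\<le>p. real (p choose j))"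
      by (intro sum_mono2) auto
    also have "\<dots> = 2 ^ p" using choose_row_sum[of p] by (metis of_nat_numeral of_nat_power of_nat_sum)
    finally show "(\<Sum>j\<in>{2..p}. real (p choose j)) \<le> 2 ^ p" .
  qed auto
  finally show ?thesis unfolding p_def .
qed

text \<open>
  The second-order term \<open>x\<^sup>2 s\<^bsup>2g-2\<^esup>\<close> is split at \<open>s\<^sup>2 = n x\<^sup>2\<close>. Above this threshold it is a fraction
  \<open>1 / n\<close> of \<open>s\<^bsup>2g\<^esup>\<close>, below it a power of \<open>x\<close> with a factor \<open>n\<^bsup>g-1\<^esup>\<close>. When \<open>n\<close> such
  increments are added, the first kind contributes only a bounded factor, and the second kind
  contributes \<open>n * n\<^bsup>g-1\<^esup> = n\<^bsup>g\<^esup>\<close>; this is where the growth rate comes from.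
\<close>

lemma even_power_increment:
  fixes s x :: real
  assumes "1 \<le> n" "1 \<le> g"
  shows "(s + x) ^ (2 * g) \<le> s ^ (2 * g) + real (2 * g) * (s ^ (2 * g - 1) * x)
           + 4 ^ g * (s ^ (2 * g) / real n + 2 * real n ^ (g - 1) * x ^ (2 * g))"
proof -
  obtain h where g: "g = Suc h" using assms by (cases g) auto
  have nonneg: "0 \<le> s ^ (2 * g) / real n" "0 \<le> real n ^ h * x ^ (2 * g)"
    by simp_all
  have "x\<^sup>2 * \<bar>s\<bar> ^ (2 * h) \<le> s ^ (2 * g) / real n + real n ^ h * x ^ (2 * g)"
  proof (cases "s\<^sup>2 \<le> real n * x\<^sup>2")
    case True
    have "x\<^sup>2 * \<bar>s\<bar> ^ (2 * h) = x\<^sup>2 * (s\<^sup>2) ^ h" by (simp add: power_mult)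
    also have "\<dots> \<le> x\<^sup>2 * (real n * x\<^sup>2) ^ h"
      using True by (intro mult_left_mono power_mono) auto
    also have "\<dots> = real n ^ h * x ^ (2 * g)"
      by (simp add: g power_mult_distrib power_mult power2_eq_square algebra_simps)
    finally show ?thesis using nonneg(1) by linarith
  next
    case False
    then have "x\<^sup>2 \<le> s\<^sup>2 / real n" using assms by (simp add: field_simps)
    then have "x\<^sup>2 * \<bar>s\<bar> ^ (2 * h) \<le> s\<^sup>2 / real n * \<bar>s\<bar> ^ (2 * h)"
      by (rule mult_right_mono) auto
    also have "\<dots> = s ^ (2 * g) / real n"
      by (simp add: g power_mult power2_eq_square)
    finally show ?thesis using nonneg(2) by linarith
  qed
  moreover have "x\<^sup>2 * \<bar>x\<bar> ^ (2 * h) \<le> real n ^ h * x ^ (2 * g)"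
  proof -
    have "x\<^sup>2 * \<bar>x\<bar> ^ (2 * h) = x ^ (2 * g)" by (simp add: g power_mult power2_eq_square)
    moreover have "1 * x ^ (2 * g) \<le> real n ^ h * x ^ (2 * g)"
      using assms by (intro mult_right_mono one_le_power) (auto simp: power_mult)
    ultimately show ?thesis by simp
  qed
  ultimately have "x\<^sup>2 * (\<bar>s\<bar> ^ (2 * h) + \<bar>x\<bar> ^ (2 * h))
      \<le> s ^ (2 * g) / real n + 2 * real n ^ h * x ^ (2 * g)"
    by (simp add: algebra_simps)
  then have "2 ^ (2 * h + 2) * (x\<^sup>2 * (\<bar>s\<bar> ^ (2 * h) + \<bar>x\<bar> ^ (2 * h)))
      \<le> 4 ^ g * (s ^ (2 * g) / real n + 2 * real n ^ h * x ^ (2 * g))"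
    by (simp add: g power_mult power_add)
  moreover have "(s + x) ^ (2 * g) \<le> s ^ (2 * g) + real (2 * g) * (s ^ (2 * g - 1) * x)
           + 2 ^ (2 * h + 2) * (x\<^sup>2 * (\<bar>s\<bar> ^ (2 * h) + \<bar>x\<bar> ^ (2 * h)))"
    using power_add_second_order[of s x "2 * h"] unfolding abs_le_iff g
    by (simp add: mult.assoc del: power_Suc)
  ultimately show ?thesis by (simp add: g)
qed

text \<open>
  Jensen's inequality for normalised weights. It takes the place of Minkowski's inequality
  when arbitrarily many lags with summable weights are superposed: moments of the superposition are
  bounded as soon as the summands have a common moment bound.
\<close>

lemma weighted_even_power_sum:
  fixes w z :: "'i \<Rightarrow> real"
  assumes "finite I" "\<And>i. i \<in> I \<Longrightarrow> 0 \<le> w i" "sum w I \<le> W" "even p" "0 < p"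
  shows "(\<Sum>i\<in>I. w i * z i) ^ p \<le> W ^ (p - 1) * (\<Sum>i\<in>I. w i * z i ^ p)"
proof -
  define V where "V = sum w I"
  have V: "0 \<le> V" unfolding V_def by (intro sum_nonneg assms)
  have pos: "0 \<le> (\<Sum>i\<in>I. w i * z i ^ p)"
    by (intro sum_nonneg mult_nonneg_nonneg assms zero_le_even_power \<open>even p\<close>)
  have "(\<Sum>i\<in>I. w i * z i) ^ p \<le> V ^ (p - 1) * (\<Sum>i\<in>I. w i * z i ^ p)"
  proof (cases "V = 0")
    case True
    then have "\<And>i. i \<in> I \<Longrightarrow> w i = 0"
      unfolding V_def using assms sum_nonneg_eq_0_iff by blast
    then show ?thesis using \<open>0 < p\<close> by (simp add: zero_power)
  next
    case False
    then have V': "0 < V" using V by simp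
    then have "I \<noteq> {}" unfolding V_def by auto
    then have "(\<Sum>i\<in>I. (w i / V) *\<^sub>R z i) ^ p \<le> (\<Sum>i\<in>I. w i / V * z i ^ p)"
      using V' assms
      by (intro convex_on_sum[OF _ _ convex_power_even[OF \<open>even p\<close>]])
        (auto simp: V_def[symmetric] simp flip: sum_divide_distrib)
    then have "V ^ p * (\<Sum>i\<in>I. (w i / V) *\<^sub>R z i) ^ p \<le> V ^ p * (\<Sum>i\<in>I. w i / V * z i ^ p)"
      using V by (intro mult_left_mono) auto
    moreover have "V ^ p * (\<Sum>i\<in>I. (w i / V) *\<^sub>R z i) ^ p = (\<Sum>i\<in>I. w i * z i) ^ p"
      using V' by (simp flip: power_mult_distrib add: sum_distrib_left)
    moreover have "V ^ p * (\<Sum>i\<in>I. w i / V * z i ^ p) = V ^ (p - 1) * (\<Sum>i\<in>I. w i * z i ^ p)"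
      using V' \<open>0 < p\<close> by (cases p) (auto simp: sum_distrib_left intro!: sum.cong)
    ultimately show ?thesis by simp
  qed
  also have "\<dots> \<le> W ^ (p - 1) * (\<Sum>i\<in>I. w i * z i ^ p)"
    using assms V pos unfolding V_def by (intro mult_right_mono power_mono)
  finally show ?thesis .
qed

lemma abs_power_mult_le:
  fixes a b :: real
  shows "\<bar>a ^ q * b\<bar> \<le> \<bar>a\<bar> ^ Suc q + \<bar>b\<bar> ^ Suc q"
proof -
  have "\<bar>a ^ q * b\<bar> \<le> max \<bar>a\<bar> \<bar>b\<bar> ^ q * max \<bar>a\<bar> \<bar>b\<bar>"
    unfolding abs_mult power_abs by (intro mult_mono power_mono) auto
  also have "\<dots> \<le> \<bar>a\<bar> ^ Suc q + \<bar>b\<bar> ^ Suc q"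
    by (cases "\<bar>a\<bar> \<le> \<bar>b\<bar>") (auto simp: max_def)
  finally show ?thesis .
qed

lemma power_add_le:
  fixes a b :: real
  assumes "0 \<le> a" "0 \<le> b"
  shows "(a + b) ^ p \<le> 2 ^ p * (a ^ p + b ^ p)"
proof -
  have "(a + b) ^ p \<le> (2 * max a b) ^ p"
    using assms by (intro power_mono) auto
  also have "\<dots> = 2 ^ p * max a b ^ p" by (simp add: power_mult_distrib)
  also have "max a b ^ p \<le> a ^ p + b ^ p"
    using assms by (cases "a \<le> b") (auto simp: max_def)
  finally show ?thesis by simp
qed

text \<open>
  A discrete Gronwall argument: a relative growth of \<open>D / n\<close> per step amounts to at most
  \<open>exp D\<close> over \<open>n\<close> steps.
\<close>

lemma perturbed_linear_growth:
  fixes a :: "nat \<Rightarrow> real"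
  assumes "a 0 = 0" and n: "1 \<le> n" and D: "0 \<le> D" and c: "0 \<le> c"
    and step: "\<And>l. l < n \<Longrightarrow> a (Suc l) \<le> a l * (1 + D / real n) + c"
  shows "a n \<le> exp D * (real n * c)"
proof -
  have r: "1 \<le> 1 + D / real n" using D by simp
  have "a l \<le> (1 + D / real n) ^ l * (real l * c)" if "l \<le> n" for l
    using that
  proof (induction l)
    case 0 then show ?case using assms by simp
  next
    case (Suc l)
    have "a (Suc l) \<le> a l * (1 + D / real n) + c" using step Suc by simp
    also have "\<dots> \<le> (1 + D / real n) ^ l * (real l * c) * (1 + D / real n) + (1 + D / real n) ^ Suc l * c"
      using Suc r c one_le_power[OF r, of "Suc l"]
      by (intro add_mono mult_right_mono) (auto simp: mult_le_cancel_right1 simp del: power_Suc)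
    also have "\<dots> = (1 + D / real n) ^ Suc l * (real (Suc l) * c)"
      by (simp add: algebra_simps add_divide_distrib)
    finally show ?case .
  qed
  from this[of n] have "a n \<le> (1 + D / real n) ^ n * (real n * c)" by simp
  also have "\<dots> \<le> exp D * (real n * c)"
  proof (rule mult_right_mono)
    show "(1 + D / real n) ^ n \<le> exp D"
      by (rule exp_ge_one_plus_x_over_n_power_n) (use D n in linarith)+
    show "0 \<le> real n * c" using c by simp
  qed
  finally show ?thesis .
qed

section \<open>Moments of sums of martingale differences\<close>

text \<open>
  Moments of order \<open>2 g\<close> of a sum of \<open>n\<close> martingale differences grow like \<open>n\<^bsup>g\<^esup>\<close>. In place of a
  filtration there is the single consequence of the martingale property that the argument uses:
  \<open>X\<^sub>l\<close> is orthogonal to the power \<open>2 g - 1\<close> of the preceding partial sum, which removes the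
  first-order term of the increment of the moment.
\<close>

lemma (in prob_space) martingale_difference_moment:
  fixes X :: "nat \<Rightarrow> 'a \<Rightarrow> real"
  assumes g: "1 \<le> g"
    and meas [measurable]: "\<And>j. X j \<in> borel_measurable M"
    and int: "\<And>j. integrable M (\<lambda>\<omega>. X j \<omega> ^ (2 * g))"
    and bound: "\<And>j. expectation (\<lambda>\<omega>. X j \<omega> ^ (2 * g)) \<le> B"
    and orth: "\<And>l. expectation (\<lambda>\<omega>. (\<Sum>j<l. X j \<omega>) ^ (2 * g - 1) * X l \<omega>) = 0"
  shows "integrable M (\<lambda>\<omega>. (\<Sum>j<n. X j \<omega>) ^ (2 * g))"
    and "expectation (\<lambda>\<omega>. (\<Sum>j<n. X j \<omega>) ^ (2 * g)) \<le> exp (4 ^ g) * (2 * 4 ^ g) * B * real n ^ g"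
proof -
  define S where "S = (\<lambda>l \<omega>. \<Sum>j<l. X j \<omega>)"
  have [measurable]: "S l \<in> borel_measurable M" for l unfolding S_def by measurable
  have intS: "integrable M (\<lambda>\<omega>. S l \<omega> ^ (2 * g))" for l
  proof (rule Bochner_Integration.integrable_bound)
    show "integrable M (\<lambda>\<omega>. real l ^ (2 * g - 1) * (\<Sum>j<l. X j \<omega> ^ (2 * g)))"
      by (intro integrable_mult_right Bochner_Integration.integrable_sum int)
    have "S l \<omega> ^ (2 * g) \<le> real l ^ (2 * g - 1) * (\<Sum>j<l. X j \<omega> ^ (2 * g))" for \<omega>
      using weighted_even_power_sum[of "{..<l}" "\<lambda>_. 1" "real l" "2 * g" "\<lambda>j. X j \<omega>"] g
      by (simp add: S_def)
    then show "AE \<omega> in M. norm (S l \<omega> ^ (2 * g))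
                 \<le> norm (real l ^ (2 * g - 1) * (\<Sum>j<l. X j \<omega> ^ (2 * g)))"
      by (intro AE_I2 norm_even_power_le) auto
  qed measurable
  then show "integrable M (\<lambda>\<omega>. (\<Sum>j<n. X j \<omega>) ^ (2 * g))" by (simp add: S_def)
  have intSX: "integrable M (\<lambda>\<omega>. S l \<omega> ^ (2 * g - 1) * X l \<omega>)" for l
  proof (rule Bochner_Integration.integrable_bound)
    show "integrable M (\<lambda>\<omega>. S l \<omega> ^ (2 * g) + X l \<omega> ^ (2 * g))"
      by (intro Bochner_Integration.integrable_add intS int)
    show "AE \<omega> in M. norm (S l \<omega> ^ (2 * g - 1) * X l \<omega>) \<le> norm (S l \<omega> ^ (2 * g) + X l \<omega> ^ (2 * g))"
      using abs_power_mult_le[of _ "2 * g - 1"] g by (simp add: power_even_abs)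
  qed measurable
  show "expectation (\<lambda>\<omega>. (\<Sum>j<n. X j \<omega>) ^ (2 * g)) \<le> exp (4 ^ g) * (2 * 4 ^ g) * B * real n ^ g"
  proof (cases "n = 0")
    case True then show ?thesis using g by (simp add: zero_power)
  next
    case False
    have B: "0 \<le> B"
      by (rule order.trans[OF integral_nonneg_AE bound[of 0]]) simp
    define a where "a = (\<lambda>l. expectation (\<lambda>\<omega>. S l \<omega> ^ (2 * g)))"
    have "a n \<le> exp (4 ^ g) * (real n * (2 * 4 ^ g * real n ^ (g - 1) * B))"
    proof (rule perturbed_linear_growth)
      show "a 0 = 0" using g by (simp add: a_def S_def)
      fix l assume "l < n"
      let ?rhs = "\<lambda>\<omega>. S l \<omega> ^ (2 * g) + real (2 * g) * (S l \<omega> ^ (2 * g - 1) * X l \<omega>)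
           + 4 ^ g * (S l \<omega> ^ (2 * g) / real n + 2 * real n ^ (g - 1) * X l \<omega> ^ (2 * g))"
      have "a (Suc l) \<le> expectation ?rhs"
        unfolding a_def
      proof (rule integral_mono)
        show "integrable M ?rhs"
          by (intro Bochner_Integration.integrable_add integrable_mult_right integrable_divide intS intSX int)
        show "S (Suc l) \<omega> ^ (2 * g) \<le> ?rhs \<omega>" for \<omega>
          using even_power_increment[of n g "S l \<omega>" "X l \<omega>"] False g by (simp add: S_def)
      qed (rule intS)
      also have "\<dots> = a l + 4 ^ g * (a l / real n + 2 * real n ^ (g - 1) * expectation (\<lambda>\<omega>. X l \<omega> ^ (2 * g)))"
        using orth[of l] intS[of l] intSX[of l] int[of l] by (simp add: a_def S_def)
      also have "\<dots> \<le> a l + 4 ^ g * (a l / real n + 2 * real n ^ (g - 1) * B)"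
        using bound by (intro add_mono mult_left_mono) auto
      finally show "a (Suc l) \<le> a l * (1 + 4 ^ g / real n) + 2 * 4 ^ g * real n ^ (g - 1) * B"
        by (simp add: algebra_simps)
    qed (use False B in auto)
    also have "\<dots> = exp (4 ^ g) * (2 * 4 ^ g) * B * real n ^ g"
      using g by (cases g) auto
    finally show ?thesis by (simp add: a_def S_def)
  qed
qed

section \<open>The driving noise and its past\<close>

text \<open>
  The lag \<open>None\<close> stands for the constant signal 1. With it, the deterministic part of a response
  is one more term of its expansion, and all products of two responses have the same form.
\<close>

definition lagged :: "'a process \<Rightarrow> nat option \<Rightarrow> 'a process" where
  "lagged e \<alpha> l \<omega> = (case \<alpha> of None \<Rightarrow> 1 | Some h \<Rightarrow> e (l - int h) \<omega>)"

locale noise = prob_space M for M :: "'a measure" +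
  fixes e :: "'a process" and g :: nat and B :: real
  assumes g: "1 \<le> g"
    and neg: "\<And>k \<omega>. k < 0 \<Longrightarrow> \<omega> \<in> space M \<Longrightarrow> e k \<omega> = 0"
    and indep: "indep_vars (\<lambda>_. borel) e {0..}"
    and centered: "\<And>k. 0 \<le> k \<Longrightarrow> expectation (e k) = 0"
    and moment_integrable: "\<And>k. 0 \<le> k \<Longrightarrow> integrable M (\<lambda>\<omega>. e k \<omega> ^ (4 * g))"
    and moment_le: "\<And>k. 0 \<le> k \<Longrightarrow> expectation (\<lambda>\<omega>. e k \<omega> ^ (4 * g)) \<le> B"
begin

text \<open>
  Variables measurable with respect to the noise before time \<open>t\<close>, in factorised form: this
  form can be composed directly with the independence of disjoint blocks of the family \<open>e\<close>.
\<close>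

definition past :: "int \<Rightarrow> ('a \<Rightarrow> real) \<Rightarrow> bool" where
  "past t Z \<longleftrightarrow> (\<exists>f\<in>borel_measurable (PiM {0..<t} (\<lambda>_. borel)).
     \<forall>\<omega>\<in>space M. Z \<omega> = f (restrict (\<lambda>i. e i \<omega>) {0..<t}))"

lemma past_const: "past t (\<lambda>_. c)"
  unfolding past_def by (rule bexI[where x = "\<lambda>_. c"]) auto

lemma past_noise:
  assumes "s < t"
  shows "past t (e s)"
proof (cases "0 \<le> s")
  case True
  then show ?thesis using assms
    unfolding past_def by (intro bexI[where x = "\<lambda>x. x s"]) (auto intro: measurable_component_singleton)
next
  case False
  then show ?thesis
    unfolding past_def by (intro bexI[where x = "\<lambda>_. 0"]) (auto simp: neg)
qed

lemma past_binary:
  assumes "past t Y" "past t Z"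
    and "case_prod h \<in> borel_measurable (borel \<Otimes>\<^sub>M borel)"
  shows "past t (\<lambda>\<omega>. h (Y \<omega>) (Z \<omega>))"
proof -
  obtain u v where [measurable]:
      "u \<in> borel_measurable (PiM {0..<t} (\<lambda>_. borel))"
      "v \<in> borel_measurable (PiM {0..<t} (\<lambda>_. borel))"
    and "\<forall>\<omega>\<in>space M. Y \<omega> = u (restrict (\<lambda>i. e i \<omega>) {0..<t})"
      "\<forall>\<omega>\<in>space M. Z \<omega> = v (restrict (\<lambda>i. e i \<omega>) {0..<t})"
    using assms(1,2) unfolding past_def by auto
  moreover have "(\<lambda>x. case_prod h (u x, v x)) \<in> borel_measurable (PiM {0..<t} (\<lambda>_. borel))"
    by (rule measurable_compose[OF _ assms(3)]) measurable
  ultimately show ?thesis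
    unfolding past_def by (intro bexI[where x = "\<lambda>x. h (u x) (v x)"]) auto
qed

lemma past_mult: "past t Y \<Longrightarrow> past t Z \<Longrightarrow> past t (\<lambda>\<omega>. Y \<omega> * Z \<omega>)"
  by (rule past_binary) measurable

lemma past_diff: "past t Y \<Longrightarrow> past t Z \<Longrightarrow> past t (\<lambda>\<omega>. Y \<omega> - Z \<omega>)"
  by (rule past_binary) measurable

lemma past_add: "past t Y \<Longrightarrow> past t Z \<Longrightarrow> past t (\<lambda>\<omega>. Y \<omega> + Z \<omega>)"
  by (rule past_binary) measurable

lemma past_power: "past t Y \<Longrightarrow> past t (\<lambda>\<omega>. Y \<omega> ^ q)"
  by (induction q) (auto intro: past_const past_mult)

lemma past_sum: "(\<And>j. j \<in> J \<Longrightarrow> past t (Y j)) \<Longrightarrow> past t (\<lambda>\<omega>. \<Sum>j\<in>J. Y j \<omega>)"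
  by (induction J rule: infinite_finite_induct) (auto intro: past_const past_add)

lemma past_lagged:
  assumes "\<And>h. \<alpha> = Some h \<Longrightarrow> l - int h < t"
  shows "past t (lagged e \<alpha> l)"
proof (cases \<alpha>)
  case None
  then have "lagged e \<alpha> l = (\<lambda>_. 1)" by (simp add: fun_eq_iff lagged_def)
  then show ?thesis by (simp add: past_const)
next
  case (Some h)
  then have "lagged e \<alpha> l = e (l - int h)" by (simp add: fun_eq_iff lagged_def)
  then show ?thesis using assms Some by (simp add: past_noise)
qed

text \<open>
  The noise at time \<open>t\<close> is independent of the block of noise before \<open>t\<close>, so the expectation of
  the product factorises.
\<close>

lemma past_innovation:
  assumes "past t Z" "0 \<le> t" and [measurable]: "h \<in> borel_measurable borel"
    and int: "integrable M Z" "integrable M (\<lambda>\<omega>. h (e t \<omega>))"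
    and h: "expectation (\<lambda>\<omega>. h (e t \<omega>)) = 0"
  shows "expectation (\<lambda>\<omega>. Z \<omega> * h (e t \<omega>)) = 0"
proof -
  obtain f where [measurable]: "f \<in> borel_measurable (PiM {0..<t} (\<lambda>_. borel))"
    and f: "\<forall>\<omega>\<in>space M. Z \<omega> = f (restrict (\<lambda>i. e i \<omega>) {0..<t})"
    using assms(1) unfolding past_def by auto
  define Z' where "Z' = f \<circ> (\<lambda>\<omega>. restrict (\<lambda>i. e i \<omega>) {0..<t})"
  define H where "H = (\<lambda>x. h (x t)) \<circ> (\<lambda>\<omega>. restrict (\<lambda>i. e i \<omega>) {t})"
  have Z: "Z' \<omega> = Z \<omega>" if "\<omega> \<in> space M" for \<omega> using f that by (simp add: Z'_def)
  have H: "H = (\<lambda>\<omega>. h (e t \<omega>))" by (auto simp: H_def)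
  have "indep_var (PiM {0..<t} (\<lambda>_. borel)) (\<lambda>\<omega>. restrict (\<lambda>i. e i \<omega>) {0..<t})
          (PiM {t} (\<lambda>_. borel)) (\<lambda>\<omega>. restrict (\<lambda>i. e i \<omega>) {t})"
    by (rule indep_var_restrict[OF indep]) (use assms(2) in auto)
  then have "indep_var borel Z' borel H"
    unfolding Z'_def H_def by (rule indep_var_compose) measurable
  moreover have "integrable M Z'" "integrable M H"
    using int Z by (auto simp: H cong: Bochner_Integration.integrable_cong)
  ultimately have "expectation (\<lambda>\<omega>. Z' \<omega> * H \<omega>) = expectation Z' * expectation H"
    by (rule indep_var_lebesgue_integral)
  moreover have "expectation (\<lambda>\<omega>. Z' \<omega> * H \<omega>) = expectation (\<lambda>\<omega>. Z \<omega> * h (e t \<omega>))"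
    by (rule Bochner_Integration.integral_cong) (auto simp: Z H)
  ultimately show ?thesis using h by (simp add: H)
qed

lemma noise_measurable [measurable]: "e k \<in> borel_measurable M"
proof (cases "0 \<le> k")
  case True
  then show ?thesis using indep by (simp add: indep_vars_def)
next
  case False
  then have "e k \<in> borel_measurable M \<longleftrightarrow> (\<lambda>_. 0 :: real) \<in> borel_measurable M"
    by (intro measurable_cong) (simp add: neg)
  then show ?thesis by simp
qed

lemma lagged_measurable [measurable]: "lagged e \<alpha> l \<in> borel_measurable M"
  by (cases \<alpha>) (simp_all add: lagged_def[abs_def])

lemma lagged_None: "lagged e None l = (\<lambda>_. 1)"
  by (simp add: lagged_def fun_eq_iff)

lemma B_nonneg: "0 \<le> B"
proof -
  have "0 \<le> expectation (\<lambda>\<omega>. e 0 \<omega> ^ (4 * g))"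
    by (intro integral_nonneg_AE AE_I2 zero_le_even_power) simp
  then show ?thesis using moment_le[of 0] by simp
qed

lemma lagged_moment:
  "integrable M (\<lambda>\<omega>. lagged e \<alpha> l \<omega> ^ (4 * g))"
  "expectation (\<lambda>\<omega>. lagged e \<alpha> l \<omega> ^ (4 * g)) \<le> 1 + B"
proof -
  have "integrable M (\<lambda>\<omega>. lagged e \<alpha> l \<omega> ^ (4 * g)) \<and>
      expectation (\<lambda>\<omega>. lagged e \<alpha> l \<omega> ^ (4 * g)) \<le> 1 + B"
  proof (cases \<alpha>)
    case None
    then show ?thesis using B_nonneg by (simp add: lagged_def prob_space)
  next
    case (Some h)
    show ?thesis
    proof (cases "0 \<le> l - int h")
      case True
      then show ?thesis
        using moment_integrable moment_le[of "l - int h"] by (simp add: lagged_def Some)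
    next
      case False
      then have "lagged e \<alpha> l \<omega> ^ (4 * g) = 0" if "\<omega> \<in> space M" for \<omega>
        using g that by (simp add: lagged_def Some neg)
      then show ?thesis
        using B_nonneg g by (simp add: zero_power cong: Bochner_Integration.integrable_cong Bochner_Integration.integral_cong)
    qed
  qed
  then show "integrable M (\<lambda>\<omega>. lagged e \<alpha> l \<omega> ^ (4 * g))"
    "expectation (\<lambda>\<omega>. lagged e \<alpha> l \<omega> ^ (4 * g)) \<le> 1 + B" by auto
qed

text \<open>
  On a probability space every moment of lower order is dominated by 1 plus the highest one.
\<close>

lemma lagged_integrable_power:
  assumes "q \<le> 4 * g"
  shows "integrable M (\<lambda>\<omega>. lagged e \<alpha> l \<omega> ^ q)"
proof (rule Bochner_Integration.integrable_bound)
  show "integrable M (\<lambda>\<omega>. 1 + lagged e \<alpha> l \<omega> ^ (4 * g))"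
    by (intro Bochner_Integration.integrable_add lagged_moment) simp
  have "\<bar>x ^ q\<bar> \<le> \<bar>1 + x ^ (4 * g)\<bar>" for x :: real
  proof -
    have x: "x ^ (4 * g) = \<bar>x\<bar> ^ (4 * g)" by (simp add: power_even_abs)
    show ?thesis
    proof (cases "\<bar>x\<bar> \<le> 1")
      case True
      have "0 \<le> x ^ (4 * g)" using even_nonneg[of x "2 * g"] by simp
      then show ?thesis
        using power_le_one[of "\<bar>x\<bar>" q] True unfolding power_abs by linarith
    next
      case False
      then have "\<bar>x\<bar> ^ q \<le> \<bar>x\<bar> ^ (4 * g)" using assms by (intro power_increasing) auto
      then show ?thesis unfolding power_abs x[symmetric] by linarith
    qed
  qed
  then show "AE \<omega> in M. norm (lagged e \<alpha> l \<omega> ^ q) \<le> norm (1 + lagged e \<alpha> l \<omega> ^ (4 * g))"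
    unfolding real_norm_def by (rule AE_I2)
qed measurable

lemma mult_even_power_le:
  fixes a b :: real
  shows "(a * b) ^ (2 * g) \<le> a ^ (4 * g) + b ^ (4 * g)"
proof -
  have "(a * b) ^ (2 * g) = a ^ (2 * g) * b ^ (2 * g)" by (simp add: power_mult_distrib)
  also have "\<dots> \<le> (a ^ (2 * g))\<^sup>2 + (b ^ (2 * g))\<^sup>2"
    using sum_squares_bound[of "a ^ (2 * g)" "b ^ (2 * g)"]
      mult_nonneg_nonneg[OF even_nonneg[of a g] even_nonneg[of b g]]
    by linarith
  also have "\<dots> = a ^ (4 * g) + b ^ (4 * g)"
    by (simp flip: power_mult add: mult.commute)
  finally show ?thesis .
qed

text \<open>
  A product of two noise variables has half as many moments as each factor; this is why
  \<open>4 g\<close> moments of the noise are needed for \<open>2 g\<close> moments of the regressor products.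
\<close>

lemma lagged_product_moment:
  "integrable M (\<lambda>\<omega>. (lagged e \<alpha> l \<omega> * lagged e \<beta> k \<omega>) ^ (2 * g))"
  "expectation (\<lambda>\<omega>. (lagged e \<alpha> l \<omega> * lagged e \<beta> k \<omega>) ^ (2 * g)) \<le> 2 * (1 + B)"
proof -
  have int: "integrable M (\<lambda>\<omega>. lagged e \<alpha> l \<omega> ^ (4 * g) + lagged e \<beta> k \<omega> ^ (4 * g))"
    by (intro Bochner_Integration.integrable_add lagged_moment)
  show 1: "integrable M (\<lambda>\<omega>. (lagged e \<alpha> l \<omega> * lagged e \<beta> k \<omega>) ^ (2 * g))"
  proof (rule Bochner_Integration.integrable_bound[OF int])
    show "AE \<omega> in M. norm ((lagged e \<alpha> l \<omega> * lagged e \<beta> k \<omega>) ^ (2 * g))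
        \<le> norm (lagged e \<alpha> l \<omega> ^ (4 * g) + lagged e \<beta> k \<omega> ^ (4 * g))"
      using mult_even_power_le
      by (intro AE_I2 norm_even_power_le) auto
  qed measurable
  have "expectation (\<lambda>\<omega>. (lagged e \<alpha> l \<omega> * lagged e \<beta> k \<omega>) ^ (2 * g))
      \<le> expectation (\<lambda>\<omega>. lagged e \<alpha> l \<omega> ^ (4 * g) + lagged e \<beta> k \<omega> ^ (4 * g))"
    by (intro integral_mono 1 int mult_even_power_le)
  also have "\<dots> \<le> 2 * (1 + B)"
    using lagged_moment[of \<alpha> l] lagged_moment[of \<beta> k] by simp
  finally show "expectation (\<lambda>\<omega>. (lagged e \<alpha> l \<omega> * lagged e \<beta> k \<omega>) ^ (2 * g)) \<le> 2 * (1 + B)" .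
qed

lemma le_one_plus_even_power: "\<bar>x :: real\<bar> \<le> 1 + x ^ (2 * g)"
proof (cases "\<bar>x\<bar> \<le> 1")
  case True
  then show ?thesis using even_nonneg[of x g] by linarith
next
  case False
  then show ?thesis
    using power_increasing[of 1 "2 * g" "\<bar>x\<bar>"] g by (simp add: power_even_abs)
qed

lemma lagged_product_integrable:
  "integrable M (\<lambda>\<omega>. lagged e \<alpha> l \<omega> * lagged e \<beta> k \<omega>)"
  "\<bar>expectation (\<lambda>\<omega>. lagged e \<alpha> l \<omega> * lagged e \<beta> k \<omega>)\<bar> \<le> 3 + 2 * B"
proof -
  have int: "integrable M (\<lambda>\<omega>. 1 + (lagged e \<alpha> l \<omega> * lagged e \<beta> k \<omega>) ^ (2 * g))"
    by (intro Bochner_Integration.integrable_add lagged_product_moment) simp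
  show 1: "integrable M (\<lambda>\<omega>. lagged e \<alpha> l \<omega> * lagged e \<beta> k \<omega>)"
    by (rule Bochner_Integration.integrable_bound[OF int])
      (auto intro!: AE_I2 order.trans[OF le_one_plus_even_power])
  have "\<bar>expectation (\<lambda>\<omega>. lagged e \<alpha> l \<omega> * lagged e \<beta> k \<omega>)\<bar>
      \<le> expectation (\<lambda>\<omega>. \<bar>lagged e \<alpha> l \<omega> * lagged e \<beta> k \<omega>\<bar>)"
    by (rule integral_abs_bound)
  also have "\<dots> \<le> expectation (\<lambda>\<omega>. 1 + (lagged e \<alpha> l \<omega> * lagged e \<beta> k \<omega>) ^ (2 * g))"
    by (intro integral_mono integrable_abs 1 int le_one_plus_even_power)
  also have "\<dots> = 1 + expectation (\<lambda>\<omega>. (lagged e \<alpha> l \<omega> * lagged e \<beta> k \<omega>) ^ (2 * g))"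
    using lagged_product_moment(1)[of \<alpha> l \<beta> k] by (simp add: prob_space)
  also have "\<dots> \<le> 3 + 2 * B" using lagged_product_moment(2)[of \<alpha> l \<beta> k] by simp
  finally show "\<bar>expectation (\<lambda>\<omega>. lagged e \<alpha> l \<omega> * lagged e \<beta> k \<omega>)\<bar> \<le> 3 + 2 * B" .
qed

section \<open>Centred products of lagged noise\<close>

definition centered_product :: "nat option \<Rightarrow> nat option \<Rightarrow> 'a process" where
  "centered_product \<alpha> \<beta> l \<omega> = lagged e \<alpha> l \<omega> * lagged e \<beta> l \<omega>
     - expectation (\<lambda>\<omega>. lagged e \<alpha> l \<omega> * lagged e \<beta> l \<omega>)"

lemma centered_product_measurable [measurable]: "centered_product \<alpha> \<beta> l \<in> borel_measurable M"
  unfolding centered_product_def[abs_def] by measurable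

lemma centered_product_commute: "centered_product \<alpha> \<beta> = centered_product \<beta> \<alpha>"
  by (simp add: centered_product_def fun_eq_iff mult.commute)

lemma centered_product_integrable: "integrable M (centered_product \<alpha> \<beta> l)"
  unfolding centered_product_def[abs_def] by (intro Bochner_Integration.integrable_diff lagged_product_integrable) simp

lemma expectation_centered_product: "expectation (centered_product \<alpha> \<beta> l) = 0"
  unfolding centered_product_def[abs_def] using lagged_product_integrable(1)[of \<alpha> l \<beta> l] by (simp add: prob_space)

definition centered_product_bound :: real where
  "centered_product_bound = 4 ^ g * (2 * (1 + B) + (3 + 2 * B) ^ (2 * g))"

lemma centered_product_moment:
  "integrable M (\<lambda>\<omega>. centered_product \<alpha> \<beta> l \<omega> ^ (2 * g))"
  "expectation (\<lambda>\<omega>. centered_product \<alpha> \<beta> l \<omega> ^ (2 * g)) \<le> centered_product_bound"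
proof -
  let ?x = "\<lambda>\<omega>. lagged e \<alpha> l \<omega> * lagged e \<beta> l \<omega>"
  let ?rhs = "\<lambda>\<omega>. 4 ^ g * (?x \<omega> ^ (2 * g) + (3 + 2 * B) ^ (2 * g))"
  have int: "integrable M ?rhs"
    by (intro integrable_mult_right Bochner_Integration.integrable_add lagged_product_moment) simp
  have le: "centered_product \<alpha> \<beta> l \<omega> ^ (2 * g) \<le> ?rhs \<omega>" for \<omega>
  proof -
    have "centered_product \<alpha> \<beta> l \<omega> ^ (2 * g) = \<bar>centered_product \<alpha> \<beta> l \<omega>\<bar> ^ (2 * g)" by (simp add: power_even_abs)
    also have "\<dots> \<le> (\<bar>?x \<omega>\<bar> + (3 + 2 * B)) ^ (2 * g)"
      using lagged_product_integrable(2)[of \<alpha> l \<beta> l]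
      by (intro power_mono) (auto simp: centered_product_def)
    also have "\<dots> \<le> 2 ^ (2 * g) * (\<bar>?x \<omega>\<bar> ^ (2 * g) + (3 + 2 * B) ^ (2 * g))"
      by (rule power_add_le) (use B_nonneg in auto)
    also have "\<dots> = ?rhs \<omega>" by (simp add: power_even_abs power_mult)
    finally show ?thesis .
  qed
  show 1: "integrable M (\<lambda>\<omega>. centered_product \<alpha> \<beta> l \<omega> ^ (2 * g))"
  proof (rule Bochner_Integration.integrable_bound[OF int])
    show "AE \<omega> in M. norm (centered_product \<alpha> \<beta> l \<omega> ^ (2 * g)) \<le> norm (?rhs \<omega>)"
      using le by (intro AE_I2 norm_even_power_le) auto
  qed measurable
  have "expectation (\<lambda>\<omega>. centered_product \<alpha> \<beta> l \<omega> ^ (2 * g)) \<le> expectation ?rhs"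
    by (intro integral_mono 1 int le)
  also have "\<dots> = 4 ^ g * (expectation (\<lambda>\<omega>. ?x \<omega> ^ (2 * g)) + (3 + 2 * B) ^ (2 * g))"
    using lagged_product_moment(1)[of \<alpha> l \<beta> l] by (simp add: prob_space)
  also have "\<dots> \<le> centered_product_bound"
    unfolding centered_product_bound_def using lagged_product_moment(2)[of \<alpha> l \<beta> l]
    by (intro mult_left_mono add_mono) auto
  finally show "expectation (\<lambda>\<omega>. centered_product \<alpha> \<beta> l \<omega> ^ (2 * g)) \<le> centered_product_bound" .
qed

lemma past_centered_product:
  assumes "\<And>h. \<alpha> = Some h \<Longrightarrow> l - int h < t" "\<And>h. \<beta> = Some h \<Longrightarrow> l - int h < t"
  shows "past t (centered_product \<alpha> \<beta> l)"
  unfolding centered_product_def[abs_def] by (intro past_diff past_mult past_lagged past_const) (use assms in auto)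

text \<open>
  Whatever the two lags are, the more recent of the two noise variables, at time \<open>t\<close>, enters the
  centered product through a factor \<open>h\<close> of mean zero, and the rest belongs to the past of \<open>t\<close>. For equal
  lags, \<open>h (e\<^sub>t)\<close> is the centered square; otherwise it is \<open>e\<^sub>t\<close> itself, multiplied by the older
  variable or by 1. For fixed lags, products at earlier times involve only noise before \<open>t\<close>, so they
  form a martingale difference sequence. The case \<open>zero\<close> covers two constant factors and
  factors at negative times.
\<close>

lemma centered_product_decomposition:
  obtains (zero) "\<And>\<omega>. \<omega> \<in> space M \<Longrightarrow> centered_product \<alpha> \<beta> l \<omega> = 0"
  | (new) t h \<kappa> where "0 \<le> t" "h \<in> borel_measurable borel"
      "integrable M (\<lambda>\<omega>. h (e t \<omega>))" "expectation (\<lambda>\<omega>. h (e t \<omega>)) = 0"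
      "past t (lagged e \<kappa> l)"
      "\<And>\<omega>. centered_product \<alpha> \<beta> l \<omega> = lagged e \<kappa> l \<omega> * h (e t \<omega>)"
      "\<And>k. k < l \<Longrightarrow> past t (centered_product \<alpha> \<beta> k)"
proof -
  define dec where "dec = (\<lambda>\<alpha> \<beta>. (\<forall>\<omega>\<in>space M. centered_product \<alpha> \<beta> l \<omega> = 0) \<or>
     (\<exists>t h \<kappa>. 0 \<le> t \<and> h \<in> borel_measurable borel \<and> integrable M (\<lambda>\<omega>. h (e t \<omega>)) \<and>
        expectation (\<lambda>\<omega>. h (e t \<omega>)) = 0 \<and> past t (lagged e \<kappa> l) \<and>
        (\<forall>\<omega>. centered_product \<alpha> \<beta> l \<omega> = lagged e \<kappa> l \<omega> * h (e t \<omega>)) \<and> (\<forall>k<l. past t (centered_product \<alpha> \<beta> k))))"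
  have sym: "dec \<alpha> \<beta> \<Longrightarrow> dec \<beta> \<alpha>" for \<alpha> \<beta>
    unfolding dec_def by (simp add: centered_product_commute[of \<beta> \<alpha>])
  have distinct: "dec (Some h) \<kappa>" if \<kappa>: "\<And>h'. \<kappa> = Some h' \<Longrightarrow> h < h'" for h \<kappa>
  proof (cases "0 \<le> l - int h")
    case False
    then have "centered_product (Some h) \<kappa> l \<omega> = 0" if "\<omega> \<in> space M" for \<omega>
      using that by (simp add: centered_product_def lagged_def neg cong: Bochner_Integration.integral_cong)
    then show ?thesis by (simp add: dec_def)
  next
    case True
    let ?t = "l - int h"
    have int: "integrable M (e ?t)"
      using lagged_integrable_power[of 1 "Some h" l] g by (simp add: lagged_def)
    have W: "past ?t (lagged e \<kappa> l)" by (rule past_lagged) (use \<kappa> in auto)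
    have "integrable M (lagged e \<kappa> l)"
      using lagged_integrable_power[of 1 \<kappa> l] g by simp
    then have "expectation (\<lambda>\<omega>. lagged e \<kappa> l \<omega> * e ?t \<omega>) = 0"
      using past_innovation[OF W True, of "\<lambda>x. x"] int centered[OF True] by simp
    then have "centered_product (Some h) \<kappa> l \<omega> = lagged e \<kappa> l \<omega> * e ?t \<omega>" for \<omega>
      by (simp add: centered_product_def lagged_def mult.commute)
    moreover have "past ?t (centered_product (Some h) \<kappa> k)" if "k < l" for k
      by (rule past_centered_product) (use \<kappa> that in \<open>fastforce+\<close>)
    ultimately show ?thesis
      unfolding dec_def using True int W centered[OF True]
      by (intro disjI2 exI[where x = ?t] exI[where x = "\<lambda>x. x"] exI[where x = \<kappa>]) auto
  qed
  have equal: "dec (Some h) (Some h)" for h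
  proof (cases "0 \<le> l - int h")
    case False
    then have "centered_product (Some h) (Some h) l \<omega> = 0" if "\<omega> \<in> space M" for \<omega>
      using that by (simp add: centered_product_def lagged_def neg cong: Bochner_Integration.integral_cong)
    then show ?thesis by (simp add: dec_def)
  next
    case True
    let ?t = "l - int h"
    let ?f = "\<lambda>x. x * x - expectation (\<lambda>\<omega>. e ?t \<omega> * e ?t \<omega>)"
    have c: "centered_product (Some h) (Some h) l = (\<lambda>\<omega>. ?f (e ?t \<omega>))"
      by (simp add: fun_eq_iff centered_product_def lagged_def)
    have "past ?t (centered_product (Some h) (Some h) k)" if "k < l" for k
      by (rule past_centered_product) (use that in auto)
    then show ?thesis
      unfolding dec_def
      using True centered_product_integrable[of "Some h" "Some h" l] expectation_centered_product[of "Some h" "Some h" l]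
      by (intro disjI2 exI[where x = ?t] exI[where x = ?f] exI[where x = None])
        (simp add: c past_const lagged_None)
  qed
  have "dec \<alpha> \<beta>"
  proof (cases \<alpha>; cases \<beta>)
    assume "\<alpha> = None" "\<beta> = None"
    then show ?thesis by (simp add: dec_def centered_product_def lagged_def prob_space)
  next
    fix h assume "\<alpha> = None" "\<beta> = Some h"
    then show ?thesis using sym distinct[of \<alpha> h] by simp
  next
    fix h assume "\<alpha> = Some h" "\<beta> = None"
    then show ?thesis using distinct[of \<beta> h] by simp
  next
    fix h h' assume *: "\<alpha> = Some h" "\<beta> = Some h'"
    consider "h = h'" | "h < h'" | "h' < h" by linarith
    then show ?thesis
      by cases (use * equal sym distinct[of \<beta> h] distinct[of \<alpha> h'] in auto)
  qed
  then show thesis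
    unfolding dec_def using zero new by blast
qed

text \<open>
  The factor \<open>h (e\<^sub>t)\<close> of the newest product is independent of everything else in the
  expectation and has mean zero.
\<close>

lemma centered_product_orthogonal:
  fixes c :: "nat \<Rightarrow> real" and \<alpha> \<beta> :: "nat option"
  defines "X \<equiv> (\<lambda>j \<omega>. c j * centered_product \<alpha> \<beta> (int j + 1) \<omega>)"
  assumes intX: "\<And>j. integrable M (\<lambda>\<omega>. X j \<omega> ^ (2 * g))"
  shows "expectation (\<lambda>\<omega>. (\<Sum>j<l. X j \<omega>) ^ (2 * g - 1) * X l \<omega>) = 0"
proof (cases rule: centered_product_decomposition[of \<alpha> \<beta> "int l + 1"])
  case zero
  then show ?thesis by (simp add: X_def cong: Bochner_Integration.integral_cong)
next
  case (new t h \<kappa>)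
  define S where "S = (\<lambda>\<omega>. \<Sum>j<l. X j \<omega>)"
  define Z where "Z = (\<lambda>\<omega>. S \<omega> ^ (2 * g - 1) * (c l * lagged e \<kappa> (int l + 1) \<omega>))"
  have [measurable]: "X j \<in> borel_measurable M" for j unfolding X_def by measurable
  have [measurable]: "S \<in> borel_measurable M" unfolding S_def by measurable
  have "past t S"
    unfolding S_def X_def by (intro past_sum past_mult past_const new) auto
  then have "past t Z"
    unfolding Z_def by (intro past_mult past_power past_const new)
  moreover have "integrable M Z"
  proof (rule Bochner_Integration.integrable_bound)
    let ?rhs = "\<lambda>\<omega>. real l ^ (2 * g - 1) * (\<Sum>j<l. X j \<omega> ^ (2 * g))
       + c l ^ (2 * g) * lagged e \<kappa> (int l + 1) \<omega> ^ (2 * g)"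
    show "integrable M ?rhs"
      by (intro Bochner_Integration.integrable_add integrable_mult_right Bochner_Integration.integrable_sum intX
          lagged_integrable_power) simp
    show "AE \<omega> in M. norm (Z \<omega>) \<le> norm (?rhs \<omega>)"
    proof (rule AE_I2)
      fix \<omega>
      have "\<bar>Z \<omega>\<bar> \<le> \<bar>S \<omega>\<bar> ^ (2 * g) + \<bar>c l * lagged e \<kappa> (int l + 1) \<omega>\<bar> ^ (2 * g)"
        using abs_power_mult_le[of "S \<omega>" "2 * g - 1"] g by (simp add: Z_def)
      also have "\<dots> = S \<omega> ^ (2 * g) + c l ^ (2 * g) * lagged e \<kappa> (int l + 1) \<omega> ^ (2 * g)"
        by (simp add: power_even_abs power_mult_distrib)
      also have "S \<omega> ^ (2 * g) \<le> real l ^ (2 * g - 1) * (\<Sum>j<l. X j \<omega> ^ (2 * g))"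
        using weighted_even_power_sum[of "{..<l}" "\<lambda>_. 1" "real l" "2 * g" "\<lambda>j. X j \<omega>"] g
        by (simp add: S_def)
      finally show "norm (Z \<omega>) \<le> norm (?rhs \<omega>)" by simp
    qed
  qed (simp add: Z_def, measurable)
  ultimately have "expectation (\<lambda>\<omega>. Z \<omega> * h (e t \<omega>)) = 0"
    using new by (intro past_innovation) auto
  moreover have "(\<lambda>\<omega>. S \<omega> ^ (2 * g - 1) * X l \<omega>) = (\<lambda>\<omega>. Z \<omega> * h (e t \<omega>))"
    by (simp add: fun_eq_iff Z_def X_def new(6))
  ultimately have "expectation (\<lambda>\<omega>. S \<omega> ^ (2 * g - 1) * X l \<omega>) = 0" by simp
  then show ?thesis unfolding S_def .
qed

definition pair_bound :: real where
  "pair_bound = exp (4 ^ g) * (2 * 4 ^ g) * centered_product_bound"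

text \<open>
  The constant depends neither on the pair of lags nor on the coefficients; this uniformity is
  what makes the superposition of all pairs of lags possible.
\<close>

lemma pair_sum_moment:
  fixes c :: "nat \<Rightarrow> real"
  assumes "\<And>j. \<bar>c j\<bar> \<le> 1"
  shows "integrable M (\<lambda>\<omega>. (\<Sum>j<n. c j * centered_product \<alpha> \<beta> (int j + 1) \<omega>) ^ (2 * g))"
    and "expectation (\<lambda>\<omega>. (\<Sum>j<n. c j * centered_product \<alpha> \<beta> (int j + 1) \<omega>) ^ (2 * g))
           \<le> pair_bound * real n ^ g"
proof -
  define X where "X = (\<lambda>j \<omega>. c j * centered_product \<alpha> \<beta> (int j + 1) \<omega>)"
  have int: "integrable M (\<lambda>\<omega>. X j \<omega> ^ (2 * g))" for j
    unfolding X_def power_mult_distrib by (intro integrable_mult_right centered_product_moment)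
  have bd: "expectation (\<lambda>\<omega>. X j \<omega> ^ (2 * g)) \<le> centered_product_bound" for j
  proof -
    have "c j ^ (2 * g) \<le> 1"
      using power_le_one[of "\<bar>c j\<bar>" "2 * g"] assms by (simp add: power_even_abs)
    moreover have "0 \<le> expectation (\<lambda>\<omega>. centered_product \<alpha> \<beta> (int j + 1) \<omega> ^ (2 * g))"
      by (intro integral_nonneg_AE AE_I2) simp
    ultimately have "expectation (\<lambda>\<omega>. X j \<omega> ^ (2 * g)) \<le> expectation (\<lambda>\<omega>. centered_product \<alpha> \<beta> (int j + 1) \<omega> ^ (2 * g))"
      by (simp add: X_def power_mult_distrib mult_left_le_one_le)
    also note centered_product_moment(2)
    finally show ?thesis .
  qed
  have orth: "expectation (\<lambda>\<omega>. (\<Sum>j<l. X j \<omega>) ^ (2 * g - 1) * X l \<omega>) = 0" for l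
    using centered_product_orthogonal[of c \<alpha> \<beta> l] int unfolding X_def by blast
  have meas: "X j \<in> borel_measurable M" for j unfolding X_def by measurable
  note * = martingale_difference_moment[OF g meas int bd orth, of n]
  show "integrable M (\<lambda>\<omega>. (\<Sum>j<n. c j * centered_product \<alpha> \<beta> (int j + 1) \<omega>) ^ (2 * g))"
    using *(1) by (simp add: X_def)
  show "expectation (\<lambda>\<omega>. (\<Sum>j<n. c j * centered_product \<alpha> \<beta> (int j + 1) \<omega>) ^ (2 * g))
           \<le> pair_bound * real n ^ g"
    using *(2) by (simp add: X_def pair_bound_def)
qed

end

section \<open>Products of linear responses\<close>

text \<open>
  Responses of a uniformly stable filter to the noise. Since the noise vanishes at negative times,
  finitely many lags suffice up to any time \<open>N\<close>; one common truncation for all times up to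
  \<open>N\<close> allows the sums over time and over lags to be interchanged. Arbitrary lag functions make
  the class closed under delays.
\<close>

definition linear_response :: "'a measure \<Rightarrow> 'a process \<Rightarrow> 'a process \<Rightarrow> bool" where
  "linear_response M e s \<longleftrightarrow> (\<exists>lag F G. summable G \<and> (\<forall>i l. \<bar>F i l\<bar> \<le> G i) \<and>
     (\<forall>N l. l \<le> int N \<longrightarrow> (\<forall>\<omega>\<in>space M. s l \<omega> = (\<Sum>i\<le>Suc N. F i l * lagged e (lag i) l \<omega>))))"

lemma linear_response_uminus:
  assumes "linear_response M e s"
  shows "linear_response M e (\<lambda>l \<omega>. - s l \<omega>)"
proof -
  obtain lag F G where *: "summable G" "\<forall>i l. \<bar>F i l\<bar> \<le> G i"
     "\<forall>N l. l \<le> int N \<longrightarrow> (\<forall>\<omega>\<in>space M. s l \<omega> = (\<Sum>i\<le>Suc N. F i l * lagged e (lag i) l \<omega>))"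
    using assms unfolding linear_response_def by blast
  show ?thesis
    unfolding linear_response_def
    by (intro exI[where x = lag] exI[where x = "\<lambda>i l. - F i l"] exI[where x = G])
      (use * in \<open>auto simp: sum_negf simp del: sum.atMost_Suc\<close>)
qed

lemma linear_response_delay:
  assumes "linear_response M e s"
  shows "linear_response M e (\<lambda>l. s (l - int p))"
proof -
  obtain lag F G where *: "summable G" "\<forall>i l. \<bar>F i l\<bar> \<le> G i"
     "\<forall>N l. l \<le> int N \<longrightarrow> (\<forall>\<omega>\<in>space M. s l \<omega> = (\<Sum>i\<le>Suc N. F i l * lagged e (lag i) l \<omega>))"
    using assms unfolding linear_response_def by blast
  have lag: "lagged e \<alpha> (l - int p) = lagged e (map_option (\<lambda>h. h + p) \<alpha>) l" for \<alpha> l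
    by (cases \<alpha>) (simp_all add: lagged_def fun_eq_iff algebra_simps)
  have "s (l - int p) \<omega> = (\<Sum>i\<le>Suc N. F i (l - int p) * lagged e (map_option (\<lambda>h. h + p) (lag i)) l \<omega>)"
    if "l \<le> int N" "\<omega> \<in> space M" for N l \<omega>
  proof -
    have "l - int p \<le> int N" using that by simp
    then show ?thesis using *(3) that by (simp only: lag)
  qed
  then show ?thesis
    unfolding linear_response_def
    by (intro exI[where x = "\<lambda>i. map_option (\<lambda>h. h + p) (lag i)"]
        exI[where x = "\<lambda>i l. F i (l - int p)"] exI[where x = G])
      (use *(1,2) in blast)
qed

text \<open>
  Coefficient 0 carries the deterministic part \<open>\<rho>\<close>, at the constant lag; coefficient
  \<open>Suc h\<close> carries the filter coefficient of lag \<open>h\<close>.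
\<close>

lemma linear_responseI:
  fixes f :: "nat \<Rightarrow> int \<Rightarrow> real"
  assumes G: "summable (\<lambda>i. \<bar>G i\<bar>)" and f: "\<And>i k. k \<ge> start \<Longrightarrow> \<bar>f i k\<bar> \<le> \<bar>G i\<bar>"
    and \<rho>: "\<And>k. k \<ge> start \<Longrightarrow> \<bar>\<rho> k\<bar> \<le> R"
    and s: "\<And>k \<omega>. k \<ge> start \<Longrightarrow> \<omega> \<in> space M \<Longrightarrow> s k \<omega> = \<rho> k + (\<Sum>i. f i k * e (k - int i) \<omega>)"
    and s0: "\<And>k \<omega>. k < start \<Longrightarrow> \<omega> \<in> space M \<Longrightarrow> s k \<omega> = 0"
    and neg: "\<And>k \<omega>. k < 0 \<Longrightarrow> \<omega> \<in> space M \<Longrightarrow> e k \<omega> = 0"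
  shows "linear_response M e s"
proof -
  define lag where "lag = (\<lambda>i. case i of 0 \<Rightarrow> None | Suc h \<Rightarrow> Some h)"
  define F where "F = (\<lambda>i l. if l < start then 0 else case i of 0 \<Rightarrow> \<rho> l | Suc h \<Rightarrow> f h l)"
  define H where "H = (\<lambda>i. case i of 0 \<Rightarrow> \<bar>R\<bar> | Suc h \<Rightarrow> \<bar>G h\<bar>)"
  have "summable (\<lambda>i. H (Suc i))" using G by (simp add: H_def)
  then have "summable H" by (simp only: summable_Suc_iff)
  moreover have "\<bar>F i l\<bar> \<le> H i" for i l
    using f \<rho>[of l] by (auto simp: F_def H_def not_less split: nat.split)
  moreover have "s l \<omega> = (\<Sum>i\<le>Suc N. F i l * lagged e (lag i) l \<omega>)"
    if l: "l \<le> int N" and \<omega>: "\<omega> \<in> space M" for N l \<omega>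
  proof (cases "l < start")
    case True
    then show ?thesis using s0 \<omega> by (simp add: F_def)
  next
    case False
    have "(\<Sum>i. f i l * e (l - int i) \<omega>) = (\<Sum>i\<le>N. f i l * e (l - int i) \<omega>)"
      by (rule suminf_finite) (use l \<omega> in \<open>auto simp: neg\<close>)
    then have "s l \<omega> = \<rho> l + (\<Sum>i\<le>N. f i l * e (l - int i) \<omega>)"
      using s False \<omega> by simp
    also have "\<dots> = F 0 l * lagged e (lag 0) l \<omega> + (\<Sum>i\<le>N. F (Suc i) l * lagged e (lag (Suc i)) l \<omega>)"
      using False by (simp add: F_def lag_def lagged_def)
    also have "\<dots> = (\<Sum>i\<le>Suc N. F i l * lagged e (lag i) l \<omega>)"
      by (rule sum.atMost_Suc_shift[symmetric])
    finally show ?thesis .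
  qed
  ultimately show ?thesis
    unfolding linear_response_def by blast
qed

lemma abs_suminf_mult_le:
  fixes f x G :: "nat \<Rightarrow> real"
  assumes G: "summable (\<lambda>i. \<bar>G i\<bar>)" and "\<And>i. \<bar>f i\<bar> \<le> \<bar>G i\<bar>" "\<And>i. \<bar>x i\<bar> \<le> R"
  shows "\<bar>\<Sum>i. f i * x i\<bar> \<le> R * (\<Sum>i. \<bar>G i\<bar>)"
proof -
  have le: "\<bar>f i * x i\<bar> \<le> \<bar>G i\<bar> * R" for i
    unfolding abs_mult using assms by (intro mult_mono) auto
  have sR: "summable (\<lambda>i. \<bar>G i\<bar> * R)" using G by (rule summable_mult2)
  have sa: "summable (\<lambda>i. \<bar>f i * x i\<bar>)"
    by (rule summable_comparison_test'[OF sR]) (use le in simp)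
  have "\<bar>\<Sum>i. f i * x i\<bar> \<le> (\<Sum>i. \<bar>f i * x i\<bar>)" by (rule summable_rabs[OF sa])
  also have "\<dots> \<le> (\<Sum>i. \<bar>G i\<bar> * R)" by (rule suminf_le[OF le sa sR])
  also have "\<dots> = R * (\<Sum>i. \<bar>G i\<bar>)" using suminf_mult2[OF G, of R] by (simp add: mult.commute)
  finally show ?thesis .
qed

context noise
begin

text \<open>
  The product of two responses is a superposition of products of lagged noise, one for each pair of
  lags, with coefficients bounded by the summable weights \<open>G i * G' k\<close>. Divided by its weight,
  each pair has the uniform moment bound, and Jensen's inequality transfers it to the sum.
\<close>

lemma product_sum_moment:
  assumes s: "linear_response M e s" and t: "linear_response M e t"
  obtains C where
    "\<And>n. integrable M (\<lambda>\<omega>. (\<Sum>j<n. s (int j + 1) \<omega> * t (int j + 1) \<omega>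
         - expectation (\<lambda>\<omega>. s (int j + 1) \<omega> * t (int j + 1) \<omega>)) ^ (2 * g))"
    "\<And>n. expectation (\<lambda>\<omega>. (\<Sum>j<n. s (int j + 1) \<omega> * t (int j + 1) \<omega>
         - expectation (\<lambda>\<omega>. s (int j + 1) \<omega> * t (int j + 1) \<omega>)) ^ (2 * g)) \<le> C * real n ^ g"
proof -
  obtain lag F G where G: "summable G" and F: "\<And>i l. \<bar>F i l\<bar> \<le> G i"
    and s_eq: "\<And>N l \<omega>. l \<le> int N \<Longrightarrow> \<omega> \<in> space M \<Longrightarrow> s l \<omega> = (\<Sum>i\<le>Suc N. F i l * lagged e (lag i) l \<omega>)"
    using s unfolding linear_response_def by blast
  obtain lag' F' G' where G': "summable G'" and F': "\<And>i l. \<bar>F' i l\<bar> \<le> G' i"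
    and t_eq: "\<And>N l \<omega>. l \<le> int N \<Longrightarrow> \<omega> \<in> space M \<Longrightarrow> t l \<omega> = (\<Sum>i\<le>Suc N. F' i l * lagged e (lag' i) l \<omega>)"
    using t unfolding linear_response_def by blast
  have G0: "0 \<le> G i" and G'0: "0 \<le> G' i" for i
    using F[of i 0] F'[of i 0] by linarith+
  define W where "W = suminf G * suminf G'"
  define w where "w = (\<lambda>(i, k). G i * G' k)"
  have w0: "0 \<le> w x" for x using G0 G'0 by (simp add: w_def split: prod.split)
  have W0: "0 \<le> W" unfolding W_def by (intro mult_nonneg_nonneg suminf_nonneg G G' G0 G'0)
  define D where "D = (\<lambda>n \<omega>. \<Sum>j<n. s (int j + 1) \<omega> * t (int j + 1) \<omega>
         - expectation (\<lambda>\<omega>. s (int j + 1) \<omega> * t (int j + 1) \<omega>))"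
  have pb: "0 \<le> pair_bound"
    using pair_sum_moment(2)[where c = "\<lambda>_. 0" and n = 1 and \<alpha> = None and \<beta> = None] g
    by (simp add: zero_power)
  have main: "integrable M (\<lambda>\<omega>. D n \<omega> ^ (2 * g)) \<and>
      expectation (\<lambda>\<omega>. D n \<omega> ^ (2 * g)) \<le> (W ^ (2 * g) * pair_bound) * real n ^ g" for n
  proof -
    define I where "I = {..Suc n} \<times> {..Suc n}"
    have finI: "finite I" by (simp add: I_def)
    define c where "c = (\<lambda>x j. F (fst x) (int j + 1) * F' (snd x) (int j + 1) / w x)"
    define z where "z = (\<lambda>x \<omega>. \<Sum>j<n. c x j * centered_product (lag (fst x)) (lag' (snd x)) (int j + 1) \<omega>)"
    have wsum: "sum w I \<le> W"
    proof -
      have "sum w I = sum G {..Suc n} * sum G' {..Suc n}"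
        by (simp add: w_def I_def sum_product sum.cartesian_product del: sum.atMost_Suc)
      also have "\<dots> \<le> W"
        unfolding W_def using G G' G0 G'0
        by (intro mult_mono sum_le_suminf suminf_nonneg sum_nonneg) auto
      finally show ?thesis .
    qed
    have FFw: "\<bar>F (fst x) l * F' (snd x) l\<bar> \<le> w x" for x l
      unfolding abs_mult w_def using F F' G0 by (auto intro!: mult_mono split: prod.split)
    have c1: "\<bar>c x j\<bar> \<le> 1" for x j
      using FFw[of x "int j + 1"] w0[of x]
      by (cases "w x = 0") (auto simp: c_def abs_mult divide_le_eq_1 abs_divide)
    \<comment> \<open>When a weight vanishes, so do all its coefficients, and the default value of division by zero does no harm.\<close>
    have wc: "w x * c x j = F (fst x) (int j + 1) * F' (snd x) (int j + 1)" for x j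
      using FFw[of x "int j + 1"] by (cases "w x = 0") (auto simp: c_def)
    have st: "s l \<omega> * t l \<omega> = (\<Sum>x\<in>I. F (fst x) l * F' (snd x) l *
          (lagged e (lag (fst x)) l \<omega> * lagged e (lag' (snd x)) l \<omega>))"
      if "l \<le> int n" "\<omega> \<in> space M" for l \<omega>
    proof -
      have "s l \<omega> * t l \<omega> = (\<Sum>i\<le>Suc n. \<Sum>k\<le>Suc n.
          (F i l * lagged e (lag i) l \<omega>) * (F' k l * lagged e (lag' k) l \<omega>))"
        using that by (simp only: s_eq[OF that] t_eq[OF that] sum_product)
      then show ?thesis
        by (simp add: I_def sum.cartesian_product case_prod_unfold mult_ac del: sum.atMost_Suc)
    qed
    have st_centered: "s l \<omega> * t l \<omega> - expectation (\<lambda>\<omega>. s l \<omega> * t l \<omega>)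
        = (\<Sum>x\<in>I. F (fst x) l * F' (snd x) l * centered_product (lag (fst x)) (lag' (snd x)) l \<omega>)"
      if "l \<le> int n" "\<omega> \<in> space M" for l \<omega>
    proof -
      have "expectation (\<lambda>\<omega>. s l \<omega> * t l \<omega>) = expectation (\<lambda>\<omega>. \<Sum>x\<in>I. F (fst x) l * F' (snd x) l *
          (lagged e (lag (fst x)) l \<omega> * lagged e (lag' (snd x)) l \<omega>))"
        by (rule Bochner_Integration.integral_cong) (use st that in auto)
      also have "\<dots> = (\<Sum>x\<in>I. F (fst x) l * F' (snd x) l *
          expectation (\<lambda>\<omega>. lagged e (lag (fst x)) l \<omega> * lagged e (lag' (snd x)) l \<omega>))"
        using lagged_product_integrable(1)
        by (subst Bochner_Integration.integral_sum) (auto intro!: integrable_mult_right)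
      finally show ?thesis
        by (simp add: st[OF that] centered_product_def sum_subtractf right_diff_distrib)
    qed
    have Deq: "D n \<omega> = (\<Sum>x\<in>I. w x * z x \<omega>)" if \<omega>: "\<omega> \<in> space M" for \<omega>
    proof -
      have "D n \<omega> = (\<Sum>j<n. \<Sum>x\<in>I. w x * c x j * centered_product (lag (fst x)) (lag' (snd x)) (int j + 1) \<omega>)"
        unfolding D_def by (intro sum.cong refl) (subst st_centered, use \<omega> wc in auto)
      also have "\<dots> = (\<Sum>x\<in>I. w x * z x \<omega>)"
        unfolding z_def by (subst sum.swap) (simp add: sum_distrib_left mult.assoc)
      finally show ?thesis .
    qed
    let ?rhs = "\<lambda>\<omega>. W ^ (2 * g - 1) * (\<Sum>x\<in>I. w x * z x \<omega> ^ (2 * g))"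
    have int_z: "integrable M (\<lambda>\<omega>. z x \<omega> ^ (2 * g))"
      and exp_z: "expectation (\<lambda>\<omega>. z x \<omega> ^ (2 * g)) \<le> pair_bound * real n ^ g" for x
      unfolding z_def using pair_sum_moment[of "c x", OF c1] by auto
    have int_rhs: "integrable M ?rhs"
      by (intro integrable_mult_right Bochner_Integration.integrable_sum int_z)
    have le: "D n \<omega> ^ (2 * g) \<le> ?rhs \<omega>" if "\<omega> \<in> space M" for \<omega>
      using weighted_even_power_sum[OF finI _ wsum, of "2 * g" "\<lambda>x. z x \<omega>"] w0 g Deq[OF that] by simp
    have int_D: "integrable M (\<lambda>\<omega>. D n \<omega> ^ (2 * g))"
    proof (rule Bochner_Integration.integrable_bound[OF int_rhs])
      have "(\<lambda>\<omega>. \<Sum>x\<in>I. w x * z x \<omega>) \<in> borel_measurable M" unfolding z_def by measurable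
      moreover have "D n \<in> borel_measurable M \<longleftrightarrow> (\<lambda>\<omega>. \<Sum>x\<in>I. w x * z x \<omega>) \<in> borel_measurable M"
        by (intro measurable_cong Deq)
      ultimately have [measurable]: "D n \<in> borel_measurable M" by simp
      show "(\<lambda>\<omega>. D n \<omega> ^ (2 * g)) \<in> borel_measurable M" by measurable
      show "AE \<omega> in M. norm (D n \<omega> ^ (2 * g)) \<le> norm (?rhs \<omega>)"
        using le by (intro AE_I2 norm_even_power_le) auto
    qed
    have "expectation (\<lambda>\<omega>. D n \<omega> ^ (2 * g)) \<le> expectation ?rhs"
      by (intro integral_mono int_D int_rhs le)
    also have "\<dots> = W ^ (2 * g - 1) * (\<Sum>x\<in>I. w x * expectation (\<lambda>\<omega>. z x \<omega> ^ (2 * g)))"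
      using int_z by (simp add: Bochner_Integration.integral_sum)
    also have "\<dots> \<le> W ^ (2 * g - 1) * (\<Sum>x\<in>I. w x * (pair_bound * real n ^ g))"
      using W0 w0 exp_z by (intro mult_left_mono sum_mono) auto
    also have "\<dots> = W ^ (2 * g - 1) * (sum w I * (pair_bound * real n ^ g))"
      by (simp only: sum_distrib_right)
    also have "\<dots> \<le> W ^ (2 * g - 1) * (W * (pair_bound * real n ^ g))"
      using W0 pb wsum by (intro mult_left_mono mult_right_mono) auto
    also have "\<dots> = (W ^ (2 * g) * pair_bound) * real n ^ g"
      using g by (cases g) auto
    finally show ?thesis using int_D by blast
  qed
  show thesis
    by (rule that[of "W ^ (2 * g) * pair_bound"]) (use main in \<open>auto simp: D_def\<close>)
qed

text \<open>
  Markov's inequality for the power \<open>2 g\<close>: the moment bound of order \<open>n\<^bsup>g\<^esup>\<close> against the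
  threshold of order \<open>n\<^bsup>2g\<^esup>\<close>.
\<close>

lemma product_sum_tail:
  fixes s t :: "'a process"
  defines "D \<equiv> (\<lambda>n \<omega>. \<Sum>j<n. s (int j + 1) \<omega> * t (int j + 1) \<omega>
         - expectation (\<lambda>\<omega>. s (int j + 1) \<omega> * t (int j + 1) \<omega>))"
  assumes "linear_response M e s" "linear_response M e t" "0 < \<eta>"
  shows "\<exists>C. \<forall>n\<ge>1. {\<omega> \<in> space M. real n * \<eta> \<le> \<bar>D n \<omega>\<bar>} \<in> events \<and>
      prob {\<omega> \<in> space M. real n * \<eta> \<le> \<bar>D n \<omega>\<bar>} \<le> C / real n ^ g"
proof -
  obtain C where int: "\<And>n. integrable M (\<lambda>\<omega>. D n \<omega> ^ (2 * g))"
    and C: "\<And>n. expectation (\<lambda>\<omega>. D n \<omega> ^ (2 * g)) \<le> C * real n ^ g"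
    using product_sum_moment[OF assms(2,3)] unfolding D_def by blast
  have "{\<omega> \<in> space M. real n * \<eta> \<le> \<bar>D n \<omega>\<bar>} \<in> events \<and>
      prob {\<omega> \<in> space M. real n * \<eta> \<le> \<bar>D n \<omega>\<bar>} \<le> (C / \<eta> ^ (2 * g)) / real n ^ g" if n: "1 \<le> n" for n
  proof -
    let ?c = "(real n * \<eta>) ^ (2 * g)"
    have c: "0 < ?c" using n \<open>0 < \<eta>\<close> by simp
    have "real n * \<eta> \<le> \<bar>x\<bar> \<longleftrightarrow> ?c \<le> x ^ (2 * g)" for x
    proof -
      have "real n * \<eta> \<le> \<bar>x\<bar> \<longleftrightarrow> ?c \<le> \<bar>x\<bar> ^ (2 * g)"
        using g \<open>0 < \<eta>\<close> by (simp add: power_mono_iff)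
      then show ?thesis by (simp add: power_even_abs)
    qed
    then have eq: "{\<omega> \<in> space M. real n * \<eta> \<le> \<bar>D n \<omega>\<bar>} = {\<omega> \<in> space M. D n \<omega> ^ (2 * g) \<ge> ?c}"
      by auto
    have [measurable]: "(\<lambda>\<omega>. D n \<omega> ^ (2 * g)) \<in> borel_measurable M" using int by auto
    have "prob {\<omega> \<in> space M. D n \<omega> ^ (2 * g) \<ge> ?c} \<le> expectation (\<lambda>\<omega>. D n \<omega> ^ (2 * g)) / ?c"
      by (rule integral_Markov_inequality_measure[where A = "{}"]) (use int c in auto)
    also have "\<dots> \<le> C * real n ^ g / ?c" using C c by (intro divide_right_mono) auto
    also have "\<dots> = (C / \<eta> ^ (2 * g)) / real n ^ g"
      using n by (simp add: power_mult_distrib mult_2 power_add)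
    finally show ?thesis unfolding eq by simp
  qed
  then show ?thesis by blast
qed

end

section \<open>Averaged expectations of delayed products\<close>

lemma sum_int_from_one: "(\<Sum>l = 1..int k. f l) = (\<Sum>j<k. f (int j + 1))"
  for f :: "int \<Rightarrow> 'b::comm_monoid_add"
proof -
  have "bij_betw (\<lambda>j. int j + 1) {..<k} {1..int k}"
    by (rule bij_betw_byWitness[where f' = "\<lambda>l. nat (l - 1)"]) auto
  then show ?thesis by (rule sum.reindex_bij_betw[symmetric])
qed

text \<open>
  Delaying by one step adds a single expectation to the sum and shifts it, and neither changes the limit
  of the averages.
\<close>

lemma avg_exp_exists_delay:
  assumes "avg_exp_exists M t"
  shows "avg_exp_exists M (\<lambda>k. t (k - int p))"
proof (induction p)
  case 0 then show ?case using assms by simp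
next
  case (Suc p)
  define v where "v = (\<lambda>k. t (k - int p))"
  obtain L where L: "mean_upto M v \<longlonglongrightarrow> L"
    using Suc unfolding avg_exp_exists_def v_def convergent_def by blast
  have eq: "mean_upto M (\<lambda>k. v (k - 1)) (Suc k)
      = integral\<^sup>L M (v 0) / real (Suc k) + real k / real (Suc k) * mean_upto M v k" for k
  proof -
    have "(\<Sum>j<Suc k. integral\<^sup>L M (v (int j))) = integral\<^sup>L M (v 0) + (\<Sum>j<k. integral\<^sup>L M (v (int j + 1)))"
      by (subst sum.lessThan_Suc_shift) (simp add: add.commute)
    then show ?thesis
      by (cases "k = 0") (simp_all add: mean_upto_def sum_int_from_one add_divide_distrib del: sum.lessThan_Suc of_nat_Suc)
  qed
  have "(\<lambda>k. integral\<^sup>L M (v 0) / real (Suc k) + real k / real (Suc k) * mean_upto M v k) \<longlonglongrightarrow> 0 + 1 * L"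
    by (intro tendsto_add tendsto_mult L LIMSEQ_n_over_Suc_n lim_const_over_n[THEN LIMSEQ_Suc])
  then have "mean_upto M (\<lambda>k. v (k - 1)) \<longlonglongrightarrow> 0 + 1 * L"
    unfolding eq[symmetric] by (rule LIMSEQ_imp_Suc)
  moreover have "(\<lambda>k. v (k - 1)) = (\<lambda>k. t (k - int (Suc p)))"
    by (simp add: v_def algebra_simps)
  ultimately show ?case unfolding avg_exp_exists_def convergent_def by auto
qed

lemma avg_exp_exists_delayed_product:
  assumes "\<And>\<tau>. avg_exp_exists M (\<lambda>k \<omega>. s k \<omega> * t (k - \<tau>) \<omega>)"
  shows "avg_exp_exists M (\<lambda>k \<omega>. s (k - int p) \<omega> * t (k - int q) \<omega>)"
  using avg_exp_exists_delay[OF assms[of "int q - int p"], of p] by (simp add: algebra_simps)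

lemma avg_exp_exists_cmult:
  assumes "avg_exp_exists M t"
  shows "avg_exp_exists M (\<lambda>k \<omega>. c * t k \<omega>)"
proof -
  have "mean_upto M (\<lambda>k \<omega>. c * t k \<omega>) = (\<lambda>k. c * mean_upto M t k)"
    by (simp add: fun_eq_iff mean_upto_def sum_distrib_left mult_ac)
  then show ?thesis
    using assms unfolding avg_exp_exists_def by (auto intro: convergent_mult convergent_const)
qed

lemma avg_exp_exists_regressor:
  assumes "jointly_quasi_stationary M y u"
  shows "avg_exp_exists M (\<lambda>k \<omega>. regressor m pos y u k \<omega> $ i * regressor m pos y u k \<omega> $ j)"
proof -
  have yy: "avg_exp_exists M (\<lambda>k \<omega>. y (k - int p) \<omega> * y (k - int q) \<omega>)"
    and uu: "avg_exp_exists M (\<lambda>k \<omega>. u (k - int p) \<omega> * u (k - int q) \<omega>)"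
    and yu: "avg_exp_exists M (\<lambda>k \<omega>. y (k - int p) \<omega> * u (k - int q) \<omega>)" for p q
    using assms by (auto simp: jointly_quasi_stationary_def quasi_stationary_def
        intro!: avg_exp_exists_delayed_product)
  have uy: "avg_exp_exists M (\<lambda>k \<omega>. u (k - int p) \<omega> * y (k - int q) \<omega>)" for p q
    using yu[of q p] by (simp add: mult.commute)
  show ?thesis
    using yy uu avg_exp_exists_cmult[OF yu, of "-1"] avg_exp_exists_cmult[OF uy, of "-1"]
    by (cases "pos i \<le> m"; cases "pos j \<le> m") (simp_all add: regressor_def del: of_nat_diff)
qed

text \<open>
  The regressor entries are delayed outputs (with a sign) and inputs, so joint
  quasi-stationarity turns the limit that defines each entry into a genuine one.
\<close>

lemma mean_regressor_matrix_limit: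
  assumes "jointly_quasi_stationary M y u"
  shows "mean_upto M (\<lambda>k \<omega>. regressor m pos y u k \<omega> $ i * regressor m pos y u k \<omega> $ j)
           \<longlonglongrightarrow> mean_regressor_matrix M m pos y u $ i $ j"
  using avg_exp_exists_regressor[OF assms, of m pos i j]
  by (simp add: avg_exp_exists_def convergent_LIMSEQ_iff mean_regressor_matrix_def
      avg_exp_matrix_def avg_exp_def outer_product_def)

section \<open>Tail bounds for the recursion\<close>

text \<open>
  The deterministic input is bounded and the filters are uniformly summable, so its contribution to
  either signal is bounded uniformly in time and can serve as the coefficient of the constant lag.
\<close>

lemma assumption_A_noise:
  assumes "prob_space M" "1 \<le> \<gamma>" "arx_system M m n a b y u d" "assumption_A M \<gamma> m pos y u"
  obtains e B where "noise M e \<gamma> B" "linear_response M e y" "linear_response M e u"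
proof -
  interpret prob_space M by fact
  obtain r e f where drv: "driving_signals M \<gamma> r e" and rep: "filter_representation M r e f y u"
    and stab: "uniformly_stable f"
    using assms(4) unfolding assumption_A_def by blast
  have neg: "e k \<omega> = 0" if "k < 0" "\<omega> \<in> space M" for k \<omega>
    using drv that by (auto simp: driving_signals_def)
  obtain B where B: "\<And>k. 0 \<le> k \<Longrightarrow> expectation (\<lambda>\<omega>. e k \<omega> ^ (4 * \<gamma>)) \<le> B"
  proof -
    have "bdd_above ((\<lambda>k. expectation (\<lambda>\<omega>. \<bar>e k \<omega>\<bar> ^ (4 * \<gamma>))) ` {0..})"
      using drv unfolding driving_signals_def by (elim conjE)
    then obtain B where "\<forall>k\<ge>0. expectation (\<lambda>\<omega>. \<bar>e k \<omega>\<bar> ^ (4 * \<gamma>)) \<le> B"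
      unfolding bdd_above_def by auto
    then show thesis by (intro that[of B]) (simp add: power_even_abs)
  qed
  have noise: "noise M e \<gamma> B"
  proof unfold_locales
    show "indep_vars (\<lambda>_. borel) e {0..}"
      using drv unfolding driving_signals_def by (elim conjE)
    have "\<forall>k\<ge>0. integrable M (e k) \<and> expectation (e k) = 0"
      using drv unfolding driving_signals_def by (elim conjE)
    then show "expectation (e k) = 0" if "0 \<le> k" for k using that by simp
    have "\<forall>k\<ge>0. integrable M (\<lambda>\<omega>. \<bar>e k \<omega>\<bar> ^ (4 * \<gamma>))"
      using drv unfolding driving_signals_def by (elim conjE)
    then show "integrable M (\<lambda>\<omega>. e k \<omega> ^ (4 * \<gamma>))" if "0 \<le> k" for k
      using that by (simp add: power_even_abs)
  qed (use assms(2) neg B in simp_all)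
  have "bounded (range r)" using drv unfolding driving_signals_def by (elim conjE)
  then obtain R where R: "\<And>k. \<bar>r k\<bar> \<le> R" by (auto simp: bounded_iff)
  obtain G where G: "summable (\<lambda>i. \<bar>G i\<bar>)"
    and f: "\<forall>k\<ge>1. \<forall>i\<ge>1. \<bar>f 1 i k\<bar> \<le> \<bar>G i\<bar>"
      "\<forall>k\<ge>1. \<forall>i. \<bar>f 2 i k\<bar> \<le> \<bar>G i\<bar>"
      "\<forall>k\<ge>0. \<forall>i. \<bar>f 3 i k\<bar> \<le> \<bar>G i\<bar>"
      "\<forall>k\<ge>0. \<forall>i. \<bar>f 4 i k\<bar> \<le> \<bar>G i\<bar>"
    using stab unfolding uniformly_stable_def by (elim exE conjE) (rule that)
  note f1 = f(1)[rule_format] and f2 = f(2)[rule_format]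
    and f3 = f(3)[rule_format] and f4 = f(4)[rule_format]
  have G1: "summable (\<lambda>i. \<bar>G (Suc i)\<bar>)" using G by (subst summable_Suc_iff)
  have "linear_response M e y"
  proof (rule linear_responseI[where start = 1 and G = G])
    show "\<bar>\<Sum>i. f 1 (Suc i) k * r (k - int (Suc i))\<bar> \<le> R * (\<Sum>i. \<bar>G (Suc i)\<bar>)" if "1 \<le> k" for k
      by (rule abs_suminf_mult_le[OF G1]) (use f1 that R in auto)
    show "y k \<omega> = (\<Sum>i. f 1 (Suc i) k * r (k - int (Suc i))) + (\<Sum>i. f 2 i k * e (k - int i) \<omega>)"
      if "1 \<le> k" "\<omega> \<in> space M" for k \<omega>
      using rep that unfolding filter_representation_def by blast
    show "y k \<omega> = 0" if "k < 1" "\<omega> \<in> space M" for k \<omega>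
      using assms(3) that by (auto simp: arx_system_def)
  qed (use G f2 neg in auto)
  moreover have "linear_response M e u"
  proof (rule linear_responseI[where start = 0 and G = G])
    show "\<bar>\<Sum>i. f 3 i k * r (k - int i)\<bar> \<le> R * (\<Sum>i. \<bar>G i\<bar>)" if "0 \<le> k" for k
      by (rule abs_suminf_mult_le[OF G]) (use f3 that R in auto)
    show "u k \<omega> = (\<Sum>i. f 3 i k * r (k - int i)) + (\<Sum>i. f 4 i k * e (k - int i) \<omega>)"
      if "0 \<le> k" "\<omega> \<in> space M" for k \<omega>
      using rep that unfolding filter_representation_def by blast
    show "u k \<omega> = 0" if "k < 0" "\<omega> \<in> space M" for k \<omega>
      using assms(3) that by (auto simp: arx_system_def)
  qed (use G f4 neg in auto)
  ultimately show thesis using that noise by blast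
qed

lemma linear_response_regressor:
  assumes "linear_response M e y" "linear_response M e u"
  shows "linear_response M e (\<lambda>k \<omega>. regressor m pos y u k \<omega> $ i)"
  using linear_response_uminus[OF linear_response_delay[OF assms(1)], of "pos i"]
    linear_response_delay[OF assms(2), of "pos i - m"]
  by (cases "pos i \<le> m") (simp_all add: regressor_def del: of_nat_diff)

theorem corollary3p1:
  fixes M :: "'a measure"
    and m n \<gamma> :: nat
    and pos :: "'d::finite \<Rightarrow> nat"
    and a b :: "nat \<Rightarrow> real"
    and y u d :: "'a process"
    and P0 :: "real ^ 'd ^ 'd"
  defines "\<Phi> \<equiv> mean_regressor_matrix M m pos y u"
    and "P \<equiv> (\<lambda>k \<omega>. rls_matrix P0 (\<lambda>l. regressor m pos y u (int l) \<omega>) k)"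
  assumes "prob_space M"
    and "\<gamma> \<ge> 1"
    and "bij_betw pos UNIV {1..m + n}"
    and "arx_system M m n a b y u d"
    and "positive_definite P0"
    and "assumption_A M \<gamma> m pos y u"
  shows "(\<forall>\<epsilon>>0. (\<lambda>k. measure M {\<omega> \<in> space M.
              spectral_norm (\<Phi> - (1 / real k) *\<^sub>R matrix_inv (P k \<omega>)) > \<epsilon>})
            \<in> O(\<lambda>k. 1 / real k ^ \<gamma>))
       \<and> (\<lambda>k. measure M {\<omega> \<in> space M.
              spectral_norm (P k \<omega>) > 2 * spectral_norm (matrix_inv \<Phi>) / real k})
            \<in> O(\<lambda>k. 1 / real k ^ \<gamma>)"
proof -
  obtain e B where "noise M e \<gamma> B" and y: "linear_response M e y" and u: "linear_response M e u"
    using assumption_A_noise assms by metis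
  then interpret noise M e \<gamma> B by simp
  have jqs: "jointly_quasi_stationary M y u" and pd: "positive_definite \<Phi>"
    using assms by (auto simp: assumption_A_def)
  define \<phi> where "\<phi> = (\<lambda>i k \<omega>. regressor m pos y u k \<omega> $ i)"
  define Z where "Z = (\<lambda>i j k \<omega>. \<phi> i k \<omega> * \<phi> j k \<omega>)"
  define D where "D = (\<lambda>i j k \<omega>. \<Sum>l<k. Z i j (int l + 1) \<omega> - expectation (Z i j (int l + 1)))"
  \<comment> \<open>Deterministic part of the error: the averages of the expectations against their limit, and the influence of \<open>P0\<close>.\<close>
  define \<Delta> where "\<Delta> = (\<lambda>k. \<Sum>i\<in>UNIV. \<Sum>j\<in>UNIV.
     \<bar>\<Phi> $ i $ j - mean_upto M (Z i j) k - matrix_inv P0 $ i $ j / real k\<bar>)"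
  have "\<Delta> \<longlonglongrightarrow> (\<Sum>i\<in>(UNIV::'d set). \<Sum>j\<in>(UNIV::'d set). \<bar>\<Phi> $ i $ j - \<Phi> $ i $ j - 0\<bar>)"
    unfolding \<Delta>_def Z_def \<phi>_def \<Phi>_def
    by (intro tendsto_intros mean_regressor_matrix_limit jqs lim_const_over_n)
  then have \<Delta>: "\<Delta> \<longlonglongrightarrow> 0" by simp
  let ?dev = "\<lambda>k \<omega>. spectral_norm (\<Phi> - (1 / real k) *\<^sub>R matrix_inv (P k \<omega>))"
  have dev: "?dev k \<omega> \<le> \<Delta> k + (\<Sum>i\<in>UNIV. \<Sum>j\<in>UNIV. \<bar>D i j k \<omega>\<bar> / real k)" for k \<omega>
  proof -
    have entry: "(\<Phi> - (1 / real k) *\<^sub>R matrix_inv (P k \<omega>)) $ i $ j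
        = (\<Phi> $ i $ j - mean_upto M (Z i j) k - matrix_inv P0 $ i $ j / real k) - D i j k \<omega> / real k" for i j
      unfolding P_def rls_matrix_inverse(1)[OF assms(7)]
      by (simp add: outer_product_def D_def Z_def \<phi>_def mean_upto_def sum_int_from_one sum_subtractf
          add.commute add_divide_distrib diff_divide_distrib)
    have "?dev k \<omega> \<le> (\<Sum>i\<in>UNIV. \<Sum>j\<in>UNIV. \<bar>(\<Phi> - (1 / real k) *\<^sub>R matrix_inv (P k \<omega>)) $ i $ j\<bar>)"
      unfolding spectral_norm_def by (rule onorm_le_matrix_component_sum)
    also have "\<dots> \<le> (\<Sum>i\<in>UNIV. \<Sum>j\<in>UNIV. \<bar>\<Phi> $ i $ j - mean_upto M (Z i j) k - matrix_inv P0 $ i $ j / real k\<bar>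
         + \<bar>D i j k \<omega>\<bar> / real k)"
      unfolding entry by (intro sum_mono order.trans[OF abs_triangle_ineq4]) simp
    finally show ?thesis by (simp add: \<Delta>_def sum.distrib)
  qed
  \<comment> \<open>Stated for events inside the deviation event, because both events of the theorem are bounded this way; only the covering events have to be measurable.\<close>
  have tail: "(\<lambda>k. prob (A k)) \<in> O(\<lambda>k. 1 / real k ^ \<gamma>)"
    if \<epsilon>: "0 < \<epsilon>" and A: "\<And>k. 1 \<le> k \<Longrightarrow> A k \<subseteq> {\<omega> \<in> space M. ?dev k \<omega> > \<epsilon>}" for \<epsilon> A
  proof -
    \<comment> \<open>Half of \<open>\<epsilon>\<close> is left to the deterministic error, and the other half is shared among the matrix entries.\<close>
    define N where "N = real CARD('d) * real CARD('d)"
    define \<eta> where "\<eta> = \<epsilon> / (2 * N)"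
    have N: "0 < N" by (simp add: N_def)
    have \<eta>: "0 < \<eta>" using N \<epsilon> by (simp add: \<eta>_def)
    let ?E = "\<lambda>k i j. {\<omega> \<in> space M. real k * \<eta> \<le> \<bar>D i j k \<omega>\<bar>}"
    have ex: "\<exists>C. \<forall>k\<ge>1. ?E k i j \<in> events \<and> prob (?E k i j) \<le> C / real k ^ \<gamma>" for i j
      unfolding D_def Z_def \<phi>_def by (intro product_sum_tail linear_response_regressor y u \<eta>)
    define C where "C = (\<lambda>i j. SOME C. \<forall>k\<ge>1. ?E k i j \<in> events \<and> prob (?E k i j) \<le> C / real k ^ \<gamma>)"
    have "\<forall>k\<ge>1. ?E k i j \<in> events \<and> prob (?E k i j) \<le> C i j / real k ^ \<gamma>" for i j
      unfolding C_def by (rule someI_ex[OF ex])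
    then have C: "\<And>i j k. 1 \<le> k \<Longrightarrow> ?E k i j \<in> events"
      "\<And>i j k. 1 \<le> k \<Longrightarrow> prob (?E k i j) \<le> C i j / real k ^ \<gamma>"
      by blast+
    have "eventually (\<lambda>k. \<Delta> k < \<epsilon> / 2) sequentially"
      using \<Delta> \<epsilon> by (intro order_tendstoD) auto
    then have "eventually (\<lambda>k. norm (prob (A k))
        \<le> (\<Sum>i\<in>UNIV. \<Sum>j\<in>UNIV. C i j) * norm (1 / real k ^ \<gamma>)) sequentially"
      using eventually_ge_at_top[of 1]
    proof eventually_elim
      case (elim k)
      have "{\<omega> \<in> space M. ?dev k \<omega> > \<epsilon>} \<subseteq> (\<Union>i\<in>UNIV. \<Union>j\<in>UNIV. ?E k i j)"
      proof (rule subsetI, rule ccontr)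
        fix \<omega> assume \<omega>: "\<omega> \<in> {\<omega> \<in> space M. ?dev k \<omega> > \<epsilon>}"
          and "\<omega> \<notin> (\<Union>i\<in>UNIV. \<Union>j\<in>UNIV. ?E k i j)"
        then have "\<bar>D i j k \<omega>\<bar> / real k \<le> \<eta>" for i j
          using elim by (auto simp: field_simps not_le intro: less_imp_le)
        then have "(\<Sum>i\<in>UNIV. \<Sum>j\<in>UNIV. \<bar>D i j k \<omega>\<bar> / real k)
            \<le> (\<Sum>i\<in>(UNIV::'d set). \<Sum>j\<in>(UNIV::'d set). \<eta>)"
          by (intro sum_mono)
        also have "\<dots> = \<epsilon> / 2" using N by (simp add: \<eta>_def N_def)
        finally show False using dev[of k \<omega>] \<omega> elim by auto
      qed
      then have "prob (A k) \<le> prob (\<Union>i\<in>UNIV. \<Union>j\<in>UNIV. ?E k i j)"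
        using C(1)[OF elim(2)] A[OF elim(2)] by (intro finite_measure_mono) auto
      also have "\<dots> \<le> (\<Sum>i\<in>UNIV. prob (\<Union>j\<in>UNIV. ?E k i j))"
        using C(1)[OF elim(2)] by (intro finite_measure_subadditive_finite) auto
      also have "\<dots> \<le> (\<Sum>i\<in>UNIV. \<Sum>j\<in>UNIV. prob (?E k i j))"
        using C(1)[OF elim(2)] by (intro sum_mono finite_measure_subadditive_finite) auto
      also have "\<dots> \<le> (\<Sum>i\<in>UNIV. \<Sum>j\<in>UNIV. C i j / real k ^ \<gamma>)"
        by (intro sum_mono C(2) elim)
      finally show ?case by (simp add: sum_divide_distrib)
    qed
    then show ?thesis by (rule bigoI)
  qed
  have "(\<lambda>k. prob {\<omega> \<in> space M. spectral_norm (P k \<omega>) > 2 * spectral_norm (matrix_inv \<Phi>) / real k})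
      \<in> O(\<lambda>k. 1 / real k ^ \<gamma>)"
  proof (rule tail)
    have inv: "matrix_inv \<Phi> ** \<Phi> = mat 1" by (rule positive_definite_inverse[OF pd])
    then show "0 < 1 / (2 * spectral_norm (matrix_inv \<Phi>))"
      using spectral_norm_inverse_pos by simp
    show "{\<omega> \<in> space M. spectral_norm (P k \<omega>) > 2 * spectral_norm (matrix_inv \<Phi>) / real k}
        \<subseteq> {\<omega> \<in> space M. ?dev k \<omega> > 1 / (2 * spectral_norm (matrix_inv \<Phi>))}" if "1 \<le> k" for k
    proof (rule Collect_mono, rule impI, elim conjE, rule conjI, assumption, rule ccontr)
      fix \<omega>
      assume large: "spectral_norm (P k \<omega>) > 2 * spectral_norm (matrix_inv \<Phi>) / real k"
        and "\<not> ?dev k \<omega> > 1 / (2 * spectral_norm (matrix_inv \<Phi>))"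
      then have "?dev k \<omega> \<le> 1 / (2 * spectral_norm (matrix_inv \<Phi>))" by simp
      moreover have "P k \<omega> ** matrix_inv (P k \<omega>) = mat 1"
        unfolding P_def by (rule rls_matrix_inverse(2)[OF assms(7)])
      ultimately have "spectral_norm (P k \<omega>) \<le> 2 * spectral_norm (matrix_inv \<Phi>) / real k"
        using that by (intro spectral_norm_inverse_perturbation[OF inv]) auto
      with large show False by simp
    qed
  qed
  moreover have "(\<lambda>k. prob {\<omega> \<in> space M. ?dev k \<omega> > \<epsilon>}) \<in> O(\<lambda>k. 1 / real k ^ \<gamma>)" if "0 < \<epsilon>" for \<epsilon>
    by (rule tail[OF that order.refl])
  ultimately show ?thesis by blast
qed

end
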